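(* Let $\mathcal{C}$ be a cluster category and let $\mathcal{T},\mathcal{U}$ be cluster-tilting subcategories of $\mathcal{C}$. Then $\operatorname{ind}_{\mathcal{T}}^{\mathcal{U}}\colon\mathsf{K}_0(\mathcal{T})\to\mathsf{K}_0(\mathcal{U})$ is an isomorphism, with inverse $\operatorname{coind}_{\mathcal{U}}^{\mathcal{T}}$.
   Context: $\mathbb{K}$ is a perfect field; categories are additive and $\mathbb{K}$-linear. Cluster categories. Extriangulated categories are those of Nakaoka--Palu: they carry a bifunctor $\operatorname{Ext}^1$, and each element of $\operatorname{Ext}^1_{\mathcal{C}}(X,Y)$ is realised by a conflation $Y\to E\to X$ (an inflation followed by a deflation). Exact categories, and triangulated categories with $\operatorname{Ext}^1(X,Y)=\operatorname{Hom}(X,\Sigma Y)$, are examples. An object $P$ is projective if $\operatorname{Ext}^1(P,-)=0$ and injective if $\operatorname{Ext}^1(-,P)=0$; $\mathcal{C}$ is Frobenius if it has enough projectives and enough injectives and these coincide. For a full additively closed subcategory $\mathcal{P}$ of projective-injectives, the additive quotient $\mathcal{C}/\mathcal{P}$ is extriangulated with $\operatorname{Ext}^1_{\mathcal{C}/\mathcal{P}}=\operatorname{Ext}^1_{\mathcal{C}}$ and conflations the images of those of $\mathcal{C}$; $\mathcal{C}$ is algebraic if it is equivalent, as an extriangulated category, to such a quotient $\mathcal{E}/\mathcal{P}$ of an exact category $\mathcal{E}$. If $\mathcal{C}$ is Frobenius, $\underline{\mathcal{C}}$ denotes its quotient by all projectives, which is triangulated with suspension $\Sigma$. A right $\mathcal{T}$-approximation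 of $X$ is a map $T_0\to X$ with $T_0\in\mathcal{T}$ through which every map from an object of $\mathcal{T}$ to $X$ factors; left approximations are dual. A full subcategory $\mathcal{T}\subseteq\mathcal{C}$ is cluster-tilting if $\mathcal{T}=\{X:\operatorname{Ext}^1(T,X)=0\ \forall T\in\mathcal{T}\}=\{X:\operatorname{Ext}^1(X,T)=0\ \forall T\in\mathcal{T}\}$ and every object of $\mathcal{C}$ has a left $\mathcal{T}$-approximation which is an inflation and a right $\mathcal{T}$-approximation which is a deflation. A cluster category is an idempotent complete algebraic Frobenius extriangulated category $\mathcal{C}$ having a cluster-tilting subcategory and such that $\underline{\mathcal{C}}$ is Hom-finite and $2$-Calabi--Yau (functorially $\operatorname{Hom}(X,Y)\cong\operatorname{Hom}_{\mathbb{K}}(\operatorname{Hom}(Y,\Sigma^2X),\mathbb{K})$). Index and coindex. $\mathsf{K}_0(\mathcal{T})$ is the Grothendieck group of $\mathcal{T}$ with its split exact structure. For $X\in\mathcal{C}$ there are conflations $K\to R\to X$ and $X\to L\to C$ with $K,R,L,C\in\mathcal{T}$; put $\operatorname{ind}_{\mathcal{C}}^{\mathcal{T}}[X]=[R]-[K]$ and $\operatorname{coind}_{\mathcal{C}}^{\mathcal{T}}[X]=[L]-[C]$ in $\mathsf{K}_0(\mathcal{T})$ (independent of choices, and additive on direct sums). For cluster-tilting subcategories $\mathcal{T},\mathcal{U}$, the homomorphisms $\operatorname{ind}_{\mathcal{U}}^{\mathcal{T}},\operatorname{coind}_{\mathcal{U}}^{\mathcal{T}}\colon\mathsf{K}_0(\mathcal{U})\to\mathsf{K}_0(\mathcal{T})$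 send $[U]$ to $\operatorname{ind}_{\mathcal{C}}^{\mathcal{T}}[U]$ and $\operatorname{coind}_{\mathcal{C}}^{\mathcal{T}}[U]$ respectively. *)

theory Defs
  imports "HOL-Computational_Algebra.Primes" "HOL-Algebra.Module" "HOL-Algebra.Free_Abelian_Groups"
begin

section \<open>Linear algebra over a field\<close>

definition perfect_field :: "('k, 'z) ring_scheme \<Rightarrow> bool" where
  "perfect_field K \<longleftrightarrow> field K \<and>
     (\<forall>p::nat. prime p \<and> add_pow K p \<one>\<^bsub>K\<^esub> = \<zero>\<^bsub>K\<^esub> \<longrightarrow>
        (\<forall>a \<in> carrier K. \<exists>b \<in> carrier K. b [^]\<^bsub>K\<^esub> p = a))"

definition linear_map ::
  "('k, 'z) ring_scheme \<Rightarrow> ('k, 'a, 'x) module_scheme \<Rightarrow> ('k, 'b, 'y) module_scheme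
     \<Rightarrow> ('a \<Rightarrow> 'b) \<Rightarrow> bool" where
  "linear_map K M N f \<longleftrightarrow> f \<in> carrier M \<rightarrow> carrier N \<and>
     (\<forall>x \<in> carrier M. \<forall>y \<in> carrier M. f (x \<oplus>\<^bsub>M\<^esub> y) = f x \<oplus>\<^bsub>N\<^esub> f y) \<and>
     (\<forall>k \<in> carrier K. \<forall>x \<in> carrier M. f (k \<odot>\<^bsub>M\<^esub> x) = k \<odot>\<^bsub>N\<^esub> f x)"

definition linear_iso ::
  "('k, 'z) ring_scheme \<Rightarrow> ('k, 'a, 'x) module_scheme \<Rightarrow> ('k, 'b, 'y) module_scheme
     \<Rightarrow> ('a \<Rightarrow> 'b) \<Rightarrow> bool" where
  "linear_iso K M N f \<longleftrightarrow> linear_map K M N f \<and> bij_betw f (carrier M) (carrier N)"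

definition finite_dimensional ::
  "('k, 'z) ring_scheme \<Rightarrow> ('k, 'a, 'x) module_scheme \<Rightarrow> bool" where
  "finite_dimensional K M \<longleftrightarrow>
     (\<exists>S. finite S \<and> S \<subseteq> carrier M \<and> (\<forall>N. submodule N K M \<and> S \<subseteq> N \<longrightarrow> N = carrier M))"

text \<open>
  The multiplicative fields of a module record carry no information, so they are left
  unspecified here and in all modules constructed below.
\<close>

definition dual_space ::
  "('k, 'z) ring_scheme \<Rightarrow> ('k, 'a, 'x) module_scheme \<Rightarrow> ('k, 'a \<Rightarrow> 'k) module" where
  "dual_space K M =
     \<lparr>carrier = {l \<in> carrier M \<rightarrow>\<^sub>E carrier K.
         (\<forall>x \<in> carrier M. \<forall>y \<in> carrier M. l (x \<oplus>\<^bsub>M\<^esub> y) = l x \<oplus>\<^bsub>K\<^esub> l y) \<and>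
         (\<forall>k \<in> carrier K. \<forall>x \<in> carrier M. l (k \<odot>\<^bsub>M\<^esub> x) = k \<otimes>\<^bsub>K\<^esub> l x)},
      monoid.mult = undefined, monoid.one = undefined,
      ring.zero = (\<lambda>x \<in> carrier M. \<zero>\<^bsub>K\<^esub>),
      ring.add = (\<lambda>l l'. \<lambda>x \<in> carrier M. l x \<oplus>\<^bsub>K\<^esub> l' x),
      smult = (\<lambda>k l. \<lambda>x \<in> carrier M. k \<otimes>\<^bsub>K\<^esub> l x)\<rparr>"


section \<open>Additive linear categories\<close>

record ('o, 'm, 'k) lincat =
  obj :: "'o set"
  Hom :: "'o \<Rightarrow> 'o \<Rightarrow> ('k, 'm) module"
  ident :: "'o \<Rightarrow> 'm"
  mcomp :: "'m \<Rightarrow> 'm \<Rightarrow> 'm" (infixl \<open>\<circ>\<index>\<close> 75)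

abbreviation homset :: "('o, 'm, 'k, 'x) lincat_scheme \<Rightarrow> 'o \<Rightarrow> 'o \<Rightarrow> 'm set" where
  "homset C X Y \<equiv> carrier (Hom C X Y)"

text \<open>
  Hom-sets are taken to be pairwise disjoint, so that a morphism determines its source and
  its target and composition can be written without mentioning objects.
\<close>

locale linear_category =
  fixes K :: "('k, 'z) ring_scheme" and C :: "('o, 'm, 'k, 'x) lincat_scheme"
  assumes field_K: "field K"
    and Hom_module: "\<lbrakk>X \<in> obj C; Y \<in> obj C\<rbrakk> \<Longrightarrow> module K (Hom C X Y)"
    and Hom_disjoint: "\<lbrakk>X \<in> obj C; Y \<in> obj C; X' \<in> obj C; Y' \<in> obj C;
        f \<in> homset C X Y; f \<in> homset C X' Y'\<rbrakk> \<Longrightarrow> X = X' \<and> Y = Y'"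
    and ident_closed: "X \<in> obj C \<Longrightarrow> ident C X \<in> homset C X X"
    and comp_closed: "\<lbrakk>X \<in> obj C; Y \<in> obj C; Z \<in> obj C; f \<in> homset C X Y; g \<in> homset C Y Z\<rbrakk>
        \<Longrightarrow> g \<circ>\<^bsub>C\<^esub> f \<in> homset C X Z"
    and comp_ident: "\<lbrakk>X \<in> obj C; Y \<in> obj C; f \<in> homset C X Y\<rbrakk> \<Longrightarrow> f \<circ>\<^bsub>C\<^esub> ident C X = f"
    and ident_comp: "\<lbrakk>X \<in> obj C; Y \<in> obj C; f \<in> homset C X Y\<rbrakk> \<Longrightarrow> ident C Y \<circ>\<^bsub>C\<^esub> f = f"
    and comp_assoc: "\<lbrakk>W \<in> obj C; X \<in> obj C; Y \<in> obj C; Z \<in> obj C;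
        f \<in> homset C W X; g \<in> homset C X Y; h \<in> homset C Y Z\<rbrakk>
        \<Longrightarrow> (h \<circ>\<^bsub>C\<^esub> g) \<circ>\<^bsub>C\<^esub> f = h \<circ>\<^bsub>C\<^esub> (g \<circ>\<^bsub>C\<^esub> f)"
    and comp_linear_right: "\<lbrakk>X \<in> obj C; Y \<in> obj C; Z \<in> obj C; g \<in> homset C Y Z\<rbrakk>
        \<Longrightarrow> linear_map K (Hom C X Y) (Hom C X Z) (\<lambda>f. g \<circ>\<^bsub>C\<^esub> f)"
    and comp_linear_left: "\<lbrakk>X \<in> obj C; Y \<in> obj C; Z \<in> obj C; f \<in> homset C X Y\<rbrakk>
        \<Longrightarrow> linear_map K (Hom C Y Z) (Hom C X Z) (\<lambda>g. g \<circ>\<^bsub>C\<^esub> f)"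

definition isomorphism :: "('o, 'm, 'k, 'x) lincat_scheme \<Rightarrow> 'o \<Rightarrow> 'o \<Rightarrow> 'm \<Rightarrow> bool" where
  "isomorphism C X Y f \<longleftrightarrow> X \<in> obj C \<and> Y \<in> obj C \<and> f \<in> homset C X Y \<and>
     (\<exists>g \<in> homset C Y X. g \<circ>\<^bsub>C\<^esub> f = ident C X \<and> f \<circ>\<^bsub>C\<^esub> g = ident C Y)"

definition zero_object :: "('o, 'm, 'k, 'x) lincat_scheme \<Rightarrow> 'o \<Rightarrow> bool" where
  "zero_object C Z \<longleftrightarrow> Z \<in> obj C \<and> ident C Z = \<zero>\<^bsub>Hom C Z Z\<^esub>"

definition biproduct ::
  "('o, 'm, 'k, 'x) lincat_scheme \<Rightarrow> 'o \<Rightarrow> 'o \<Rightarrow> 'o \<Rightarrow> 'm \<Rightarrow> 'm \<Rightarrow> 'm \<Rightarrow> 'm \<Rightarrow> bool" where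
  "biproduct C X Y S i1 i2 p1 p2 \<longleftrightarrow>
     X \<in> obj C \<and> Y \<in> obj C \<and> S \<in> obj C \<and>
     i1 \<in> homset C X S \<and> i2 \<in> homset C Y S \<and> p1 \<in> homset C S X \<and> p2 \<in> homset C S Y \<and>
     p1 \<circ>\<^bsub>C\<^esub> i1 = ident C X \<and> p2 \<circ>\<^bsub>C\<^esub> i2 = ident C Y \<and>
     p1 \<circ>\<^bsub>C\<^esub> i2 = \<zero>\<^bsub>Hom C Y X\<^esub> \<and> p2 \<circ>\<^bsub>C\<^esub> i1 = \<zero>\<^bsub>Hom C X Y\<^esub> \<and>
     (i1 \<circ>\<^bsub>C\<^esub> p1) \<oplus>\<^bsub>Hom C S S\<^esub> (i2 \<circ>\<^bsub>C\<^esub> p2) = ident C S"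

locale additive_category = linear_category +
  assumes zero_object_exists: "\<exists>Z. zero_object C Z"
    and biproduct_exists: "\<lbrakk>X \<in> obj C; Y \<in> obj C\<rbrakk> \<Longrightarrow> \<exists>S i1 i2 p1 p2. biproduct C X Y S i1 i2 p1 p2"

definition idempotent_complete :: "('o, 'm, 'k, 'x) lincat_scheme \<Rightarrow> bool" where
  "idempotent_complete C \<longleftrightarrow>
     (\<forall>X \<in> obj C. \<forall>e \<in> homset C X X. e \<circ>\<^bsub>C\<^esub> e = e \<longrightarrow>
        (\<exists>Y \<in> obj C. \<exists>r \<in> homset C X Y. \<exists>s \<in> homset C Y X.
            s \<circ>\<^bsub>C\<^esub> r = e \<and> r \<circ>\<^bsub>C\<^esub> s = ident C Y))"

definition additively_closed :: "('o, 'm, 'k, 'x) lincat_scheme \<Rightarrow> 'o set \<Rightarrow> bool" where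
  "additively_closed C P \<longleftrightarrow> P \<subseteq> obj C \<and> (\<forall>Z. zero_object C Z \<longrightarrow> Z \<in> P) \<and>
     (\<forall>X Y S i1 i2 p1 p2. biproduct C X Y S i1 i2 p1 p2 \<longrightarrow> (S \<in> P \<longleftrightarrow> X \<in> P \<and> Y \<in> P))"

text \<open>
  For biproducts \<open>W = Y \<oplus> Y'\<close> with projections \<open>q1, q2\<close> and \<open>D = B \<oplus> B'\<close> with
  injections \<open>k1, k2\<close>, this is the morphism \<open>f \<oplus> f' : W \<rightarrow> D\<close>.
\<close>

definition mor_sum ::
  "('o, 'm, 'k, 'x) lincat_scheme \<Rightarrow> 'o \<Rightarrow> 'm \<Rightarrow> 'm \<Rightarrow> 'o \<Rightarrow> 'm \<Rightarrow> 'm \<Rightarrow> 'm \<Rightarrow> 'm \<Rightarrow> 'm" where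
  "mor_sum C W q1 q2 D k1 k2 f f' =
     (k1 \<circ>\<^bsub>C\<^esub> f \<circ>\<^bsub>C\<^esub> q1) \<oplus>\<^bsub>Hom C W D\<^esub> (k2 \<circ>\<^bsub>C\<^esub> f' \<circ>\<^bsub>C\<^esub> q2)"

definition composable :: "('o, 'm, 'k, 'x) lincat_scheme \<Rightarrow> 'o \<Rightarrow> 'o \<Rightarrow> 'o \<Rightarrow> 'm \<Rightarrow> 'm \<Rightarrow> bool" where
  "composable C A B Z x y \<longleftrightarrow>
     A \<in> obj C \<and> B \<in> obj C \<and> Z \<in> obj C \<and> x \<in> homset C A B \<and> y \<in> homset C B Z"

text \<open>Two sequences \<open>A \<rightarrow> B \<rightarrow> Z\<close> and \<open>A \<rightarrow> B' \<rightarrow> Z\<close> are equivalent if they are isomorphic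
  via an isomorphism which is the identity on both ends.\<close>

definition seq_equiv ::
  "('o, 'm, 'k, 'x) lincat_scheme \<Rightarrow> 'o \<Rightarrow> 'o \<Rightarrow> 'm \<times> 'm \<Rightarrow> 'm \<times> 'm \<Rightarrow> bool" where
  "seq_equiv C A Z s s' \<longleftrightarrow>
     (\<exists>B B' b. composable C A B Z (fst s) (snd s) \<and> composable C A B' Z (fst s') (snd s') \<and>
        isomorphism C B B' b \<and> b \<circ>\<^bsub>C\<^esub> fst s = fst s' \<and> snd s' \<circ>\<^bsub>C\<^esub> b = snd s)"


section \<open>Extriangulated categories\<close>

text \<open>
  \<open>Ext C X Y\<close> is the space of extensions of \<open>X\<close> by \<open>Y\<close>. For \<open>\<delta>\<close> in it,
  \<open>push C X a \<delta>\<close> is \<open>a\<^sub>*\<delta>\<close> for \<open>a : Y \<rightarrow> Y'\<close>, while \<open>pull C Y c \<delta>\<close> is \<open>c\<^sup>*\<delta>\<close> for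
  \<open>c : X' \<rightarrow> X\<close>, and \<open>realise C X Y \<delta>\<close> is the equivalence class of sequences
  \<open>Y \<rightarrow> B \<rightarrow> X\<close> realising \<open>\<delta>\<close>. The spaces of extensions need not be disjoint, hence the
  additional object arguments.
\<close>

record ('o, 'm, 'k, 'e) extcat = "('o, 'm, 'k) lincat" +
  Ext :: "'o \<Rightarrow> 'o \<Rightarrow> ('k, 'e) module"
  push :: "'o \<Rightarrow> 'm \<Rightarrow> 'e \<Rightarrow> 'e"
  pull :: "'o \<Rightarrow> 'm \<Rightarrow> 'e \<Rightarrow> 'e"
  realise :: "'o \<Rightarrow> 'o \<Rightarrow> 'e \<Rightarrow> ('m \<times> 'm) set"

definition etriangle ::
  "('o, 'm, 'k, 'e, 'x) extcat_scheme \<Rightarrow> 'o \<Rightarrow> 'o \<Rightarrow> 'o \<Rightarrow> 'm \<Rightarrow> 'm \<Rightarrow> 'e \<Rightarrow> bool" where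
  "etriangle C A B Z x y \<delta> \<longleftrightarrow>
     composable C A B Z x y \<and> \<delta> \<in> carrier (Ext C Z A) \<and> (x, y) \<in> realise C Z A \<delta>"

definition conflation ::
  "('o, 'm, 'k, 'e, 'x) extcat_scheme \<Rightarrow> 'o \<Rightarrow> 'o \<Rightarrow> 'o \<Rightarrow> 'm \<Rightarrow> 'm \<Rightarrow> bool" where
  "conflation C A B Z x y \<longleftrightarrow> (\<exists>\<delta>. etriangle C A B Z x y \<delta>)"

definition inflation :: "('o, 'm, 'k, 'e, 'x) extcat_scheme \<Rightarrow> 'o \<Rightarrow> 'o \<Rightarrow> 'm \<Rightarrow> bool" where
  "inflation C A B x \<longleftrightarrow> (\<exists>Z y. conflation C A B Z x y)"

definition deflation :: "('o, 'm, 'k, 'e, 'x) extcat_scheme \<Rightarrow> 'o \<Rightarrow> 'o \<Rightarrow> 'm \<Rightarrow> bool" where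
  "deflation C B Z y \<longleftrightarrow> (\<exists>A x. conflation C A B Z x y)"

text \<open>The axioms (ET1)--(ET4) and their duals of Nakaoka and Palu, in the \<open>K\<close>-linear setting.\<close>

locale extriangulated_category = additive_category K C
  for K :: "('k, 'z) ring_scheme" and C :: "('o, 'm, 'k, 'e, 'x) extcat_scheme" +
  assumes Ext_module: "\<lbrakk>X \<in> obj C; Y \<in> obj C\<rbrakk> \<Longrightarrow> module K (Ext C X Y)"
    and push_linear: "\<lbrakk>X \<in> obj C; Y \<in> obj C; Y' \<in> obj C; a \<in> homset C Y Y'\<rbrakk>
        \<Longrightarrow> linear_map K (Ext C X Y) (Ext C X Y') (push C X a)"
    and push_linear_mor: "\<lbrakk>X \<in> obj C; Y \<in> obj C; Y' \<in> obj C; \<delta> \<in> carrier (Ext C X Y)\<rbrakk>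
        \<Longrightarrow> linear_map K (Hom C Y Y') (Ext C X Y') (\<lambda>a. push C X a \<delta>)"
    and push_ident: "\<lbrakk>X \<in> obj C; Y \<in> obj C; \<delta> \<in> carrier (Ext C X Y)\<rbrakk>
        \<Longrightarrow> push C X (ident C Y) \<delta> = \<delta>"
    and push_comp: "\<lbrakk>X \<in> obj C; Y \<in> obj C; Y' \<in> obj C; Y'' \<in> obj C;
        a \<in> homset C Y Y'; a' \<in> homset C Y' Y''; \<delta> \<in> carrier (Ext C X Y)\<rbrakk>
        \<Longrightarrow> push C X (a' \<circ>\<^bsub>C\<^esub> a) \<delta> = push C X a' (push C X a \<delta>)"
    and pull_linear: "\<lbrakk>X \<in> obj C; X' \<in> obj C; Y \<in> obj C; c \<in> homset C X' X\<rbrakk>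
        \<Longrightarrow> linear_map K (Ext C X Y) (Ext C X' Y) (pull C Y c)"
    and pull_linear_mor: "\<lbrakk>X \<in> obj C; X' \<in> obj C; Y \<in> obj C; \<delta> \<in> carrier (Ext C X Y)\<rbrakk>
        \<Longrightarrow> linear_map K (Hom C X' X) (Ext C X' Y) (\<lambda>c. pull C Y c \<delta>)"
    and pull_ident: "\<lbrakk>X \<in> obj C; Y \<in> obj C; \<delta> \<in> carrier (Ext C X Y)\<rbrakk>
        \<Longrightarrow> pull C Y (ident C X) \<delta> = \<delta>"
    and pull_comp: "\<lbrakk>X \<in> obj C; X' \<in> obj C; X'' \<in> obj C; Y \<in> obj C;
        c \<in> homset C X' X; c' \<in> homset C X'' X'; \<delta> \<in> carrier (Ext C X Y)\<rbrakk>
        \<Longrightarrow> pull C Y (c \<circ>\<^bsub>C\<^esub> c') \<delta> = pull C Y c' (pull C Y c \<delta>)"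
    and pull_push: "\<lbrakk>X \<in> obj C; X' \<in> obj C; Y \<in> obj C; Y' \<in> obj C;
        a \<in> homset C Y Y'; c \<in> homset C X' X; \<delta> \<in> carrier (Ext C X Y)\<rbrakk>
        \<Longrightarrow> pull C Y' c (push C X a \<delta>) = push C X' a (pull C Y c \<delta>)"
    and real_class: "\<lbrakk>X \<in> obj C; Y \<in> obj C; \<delta> \<in> carrier (Ext C X Y)\<rbrakk>
        \<Longrightarrow> \<exists>B x y. composable C Y B X x y \<and> realise C X Y \<delta> = {s. seq_equiv C Y X (x, y) s}"
    and real_morphism: "\<lbrakk>etriangle C A B Z x y \<delta>; etriangle C A' B' Z' x' y' \<delta>';
        a \<in> homset C A A'; c \<in> homset C Z Z'; push C Z a \<delta> = pull C A' c \<delta>'\<rbrakk>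
        \<Longrightarrow> \<exists>b \<in> homset C B B'. b \<circ>\<^bsub>C\<^esub> x = x' \<circ>\<^bsub>C\<^esub> a \<and> y' \<circ>\<^bsub>C\<^esub> b = c \<circ>\<^bsub>C\<^esub> y"
    and real_zero: "biproduct C A Z S i1 i2 p1 p2 \<Longrightarrow> (i1, p2) \<in> realise C Z A \<zero>\<^bsub>Ext C Z A\<^esub>"
    and real_sum: "\<lbrakk>etriangle C A B Z x y \<delta>; etriangle C A' B' Z' x' y' \<delta>';
        biproduct C A A' AS iA iA' pA pA'; biproduct C B B' BS iB iB' pB pB';
        biproduct C Z Z' ZS iZ iZ' pZ pZ'\<rbrakk>
        \<Longrightarrow> (mor_sum C AS pA pA' BS iB iB' x x', mor_sum C BS pB pB' ZS iZ iZ' y y') \<in>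
              realise C ZS AS (push C ZS iA (pull C A pZ \<delta>) \<oplus>\<^bsub>Ext C ZS AS\<^esub>
                            push C ZS iA' (pull C A' pZ' \<delta>'))"
    and ET3: "\<lbrakk>etriangle C A B Z x y \<delta>; etriangle C A' B' Z' x' y' \<delta>';
        a \<in> homset C A A'; b \<in> homset C B B'; b \<circ>\<^bsub>C\<^esub> x = x' \<circ>\<^bsub>C\<^esub> a\<rbrakk>
        \<Longrightarrow> \<exists>c \<in> homset C Z Z'. c \<circ>\<^bsub>C\<^esub> y = y' \<circ>\<^bsub>C\<^esub> b \<and> push C Z a \<delta> = pull C A' c \<delta>'"
    and ET3_op: "\<lbrakk>etriangle C A B Z x y \<delta>; etriangle C A' B' Z' x' y' \<delta>';
        b \<in> homset C B B'; c \<in> homset C Z Z'; c \<circ>\<^bsub>C\<^esub> y = y' \<circ>\<^bsub>C\<^esub> b\<rbrakk>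
        \<Longrightarrow> \<exists>a \<in> homset C A A'. b \<circ>\<^bsub>C\<^esub> x = x' \<circ>\<^bsub>C\<^esub> a \<and> push C Z a \<delta> = pull C A' c \<delta>'"
    and ET4: "\<lbrakk>etriangle C A B D f f' \<delta>; etriangle C B Z F g g' \<delta>'\<rbrakk>
        \<Longrightarrow> \<exists>E h' d e \<delta>''. etriangle C A Z E (g \<circ>\<^bsub>C\<^esub> f) h' \<delta>'' \<and>
              etriangle C D E F d e (push C F f' \<delta>') \<and>
              h' \<circ>\<^bsub>C\<^esub> g = d \<circ>\<^bsub>C\<^esub> f' \<and> e \<circ>\<^bsub>C\<^esub> h' = g' \<and>
              pull C A d \<delta>'' = \<delta> \<and> push C E f \<delta>'' = pull C B e \<delta>'"
    and ET4_op: "\<lbrakk>etriangle C D A B f' f \<delta>; etriangle C F B Z g' g \<delta>'\<rbrakk>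
        \<Longrightarrow> \<exists>E h' d e \<delta>''. etriangle C E A Z h' (g \<circ>\<^bsub>C\<^esub> f) \<delta>'' \<and>
              etriangle C D E F d e (pull C D g' \<delta>) \<and>
              h' \<circ>\<^bsub>C\<^esub> d = f' \<and> f \<circ>\<^bsub>C\<^esub> h' = g' \<circ>\<^bsub>C\<^esub> e \<and>
              push C Z e \<delta>'' = \<delta>' \<and> push C B d \<delta> = pull C E g \<delta>''"

definition projectives :: "('o, 'm, 'k, 'e, 'x) extcat_scheme \<Rightarrow> 'o set" where
  "projectives C = {P \<in> obj C. \<forall>Y \<in> obj C. carrier (Ext C P Y) = {\<zero>\<^bsub>Ext C P Y\<^esub>}}"

definition injectives :: "('o, 'm, 'k, 'e, 'x) extcat_scheme \<Rightarrow> 'o set" where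
  "injectives C = {I \<in> obj C. \<forall>X \<in> obj C. carrier (Ext C X I) = {\<zero>\<^bsub>Ext C X I\<^esub>}}"

definition frobenius :: "('o, 'm, 'k, 'e, 'x) extcat_scheme \<Rightarrow> bool" where
  "frobenius C \<longleftrightarrow>
     (\<forall>X \<in> obj C. \<exists>P \<in> projectives C. \<exists>y. deflation C P X y) \<and>
     (\<forall>X \<in> obj C. \<exists>I \<in> injectives C. \<exists>x. inflation C X I x) \<and>
     projectives C = injectives C"


section \<open>Additive quotients\<close>

definition factors_through ::
  "('o, 'm, 'k, 'x) lincat_scheme \<Rightarrow> 'o set \<Rightarrow> 'o \<Rightarrow> 'o \<Rightarrow> 'm \<Rightarrow> bool" where
  "factors_through C P X Y f \<longleftrightarrow>
     (\<exists>Q \<in> P. \<exists>u \<in> homset C X Q. \<exists>v \<in> homset C Q Y. f = v \<circ>\<^bsub>C\<^esub> u)"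

definition quot_cong :: "('o, 'm, 'k, 'x) lincat_scheme \<Rightarrow> 'o set \<Rightarrow> 'm \<Rightarrow> 'm \<Rightarrow> bool" where
  "quot_cong C P f g \<longleftrightarrow>
     (\<exists>X \<in> obj C. \<exists>Y \<in> obj C. f \<in> homset C X Y \<and> g \<in> homset C X Y \<and>
        factors_through C P X Y (f \<ominus>\<^bsub>Hom C X Y\<^esub> g))"

text \<open>
  Morphisms of the quotient are congruence classes. An operation on classes is computed by
  applying it elementwise and saturating the result; on classes this gives the class of the
  result for any choice of representatives.
\<close>

definition quot_sat :: "('o, 'm, 'k, 'x) lincat_scheme \<Rightarrow> 'o set \<Rightarrow> 'm set \<Rightarrow> 'm set" where
  "quot_sat C P S = {h. \<exists>f \<in> S. quot_cong C P f h}"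

definition quot_Hom ::
  "('o, 'm, 'k, 'x) lincat_scheme \<Rightarrow> 'o set \<Rightarrow> 'o \<Rightarrow> 'o \<Rightarrow> ('k, 'm set) module" where
  "quot_Hom C P X Y =
     \<lparr>carrier = (\<lambda>f. quot_sat C P {f}) ` homset C X Y,
      monoid.mult = undefined, monoid.one = undefined,
      ring.zero = quot_sat C P {\<zero>\<^bsub>Hom C X Y\<^esub>},
      ring.add = (\<lambda>F G. quot_sat C P {f \<oplus>\<^bsub>Hom C X Y\<^esub> g | f g. f \<in> F \<and> g \<in> G}),
      smult = (\<lambda>k F. quot_sat C P {k \<odot>\<^bsub>Hom C X Y\<^esub> f | f. f \<in> F})\<rparr>"

definition quot_lincat ::
  "('o, 'm, 'k, 'x) lincat_scheme \<Rightarrow> 'o set \<Rightarrow> ('o, 'm set, 'k) lincat" where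
  "quot_lincat C P =
     \<lparr>obj = obj C,
      Hom = quot_Hom C P,
      ident = (\<lambda>X. quot_sat C P {ident C X}),
      mcomp = (\<lambda>G F. quot_sat C P {g \<circ>\<^bsub>C\<^esub> f | g f. g \<in> G \<and> f \<in> F \<and>
         (\<exists>X \<in> obj C. \<exists>Y \<in> obj C. \<exists>Z \<in> obj C. f \<in> homset C X Y \<and> g \<in> homset C Y Z)})\<rparr>"

text \<open>
  The extension spaces do not change. The actions are independent of representatives since
  all objects of \<open>P\<close> are required to be projective and injective whenever this is used.
\<close>

definition quot_extcat ::
  "('o, 'm, 'k, 'e, 'x) extcat_scheme \<Rightarrow> 'o set \<Rightarrow> ('o, 'm set, 'k, 'e) extcat" where
  "quot_extcat C P =
     \<lparr>obj = obj (quot_lincat C P), Hom = Hom (quot_lincat C P),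
      ident = ident (quot_lincat C P), mcomp = mcomp (quot_lincat C P),
      Ext = Ext C,
      push = (\<lambda>X A \<delta>. the_elem ((\<lambda>a. push C X a \<delta>) ` A)),
      pull = (\<lambda>Y B \<delta>. the_elem ((\<lambda>c. pull C Y c \<delta>) ` B)),
      realise = (\<lambda>X Y \<delta>. {s. \<exists>(x, y) \<in> realise C X Y \<delta>.
         seq_equiv (quot_lincat C P) Y X (quot_sat C P {x}, quot_sat C P {y}) s})\<rparr>"


section \<open>Exact categories and their extensions\<close>

record ('o, 'm, 'k) exactcat = "('o, 'm, 'k) lincat" +
  confl :: "('m \<times> 'm) set"

definition exact_seq ::
  "('o, 'm, 'k, 'x) exactcat_scheme \<Rightarrow> 'o \<Rightarrow> 'o \<Rightarrow> 'o \<Rightarrow> 'm \<Rightarrow> 'm \<Rightarrow> bool" where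
  "exact_seq E A B Z i p \<longleftrightarrow> composable E A B Z i p \<and> (i, p) \<in> confl E"

definition adm_mono :: "('o, 'm, 'k, 'x) exactcat_scheme \<Rightarrow> 'o \<Rightarrow> 'o \<Rightarrow> 'm \<Rightarrow> bool" where
  "adm_mono E A B i \<longleftrightarrow> (\<exists>Z p. exact_seq E A B Z i p)"

definition adm_epi :: "('o, 'm, 'k, 'x) exactcat_scheme \<Rightarrow> 'o \<Rightarrow> 'o \<Rightarrow> 'm \<Rightarrow> bool" where
  "adm_epi E B Z p \<longleftrightarrow> (\<exists>A i. exact_seq E A B Z i p)"

definition is_kernel ::
  "('o, 'm, 'k, 'x) lincat_scheme \<Rightarrow> 'o \<Rightarrow> 'o \<Rightarrow> 'o \<Rightarrow> 'm \<Rightarrow> 'm \<Rightarrow> bool" where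
  "is_kernel C A B Z i p \<longleftrightarrow> composable C A B Z i p \<and> p \<circ>\<^bsub>C\<^esub> i = \<zero>\<^bsub>Hom C A Z\<^esub> \<and>
     (\<forall>W \<in> obj C. \<forall>f \<in> homset C W B. p \<circ>\<^bsub>C\<^esub> f = \<zero>\<^bsub>Hom C W Z\<^esub> \<longrightarrow>
        (\<exists>!g. g \<in> homset C W A \<and> i \<circ>\<^bsub>C\<^esub> g = f))"

definition is_cokernel ::
  "('o, 'm, 'k, 'x) lincat_scheme \<Rightarrow> 'o \<Rightarrow> 'o \<Rightarrow> 'o \<Rightarrow> 'm \<Rightarrow> 'm \<Rightarrow> bool" where
  "is_cokernel C A B Z i p \<longleftrightarrow> composable C A B Z i p \<and> p \<circ>\<^bsub>C\<^esub> i = \<zero>\<^bsub>Hom C A Z\<^esub> \<and>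
     (\<forall>W \<in> obj C. \<forall>f \<in> homset C B W. f \<circ>\<^bsub>C\<^esub> i = \<zero>\<^bsub>Hom C A W\<^esub> \<longrightarrow>
        (\<exists>!g. g \<in> homset C Z W \<and> g \<circ>\<^bsub>C\<^esub> p = f))"

definition is_pushout ::
  "('o, 'm, 'k, 'x) lincat_scheme \<Rightarrow> 'o \<Rightarrow> 'o \<Rightarrow> 'o \<Rightarrow> 'o \<Rightarrow> 'm \<Rightarrow> 'm \<Rightarrow> 'm \<Rightarrow> 'm \<Rightarrow> bool" where
  "is_pushout C A B A' B' i a i' b \<longleftrightarrow>
     composable C A B B' i b \<and> composable C A A' B' a i' \<and> b \<circ>\<^bsub>C\<^esub> i = i' \<circ>\<^bsub>C\<^esub> a \<and>
     (\<forall>W \<in> obj C. \<forall>u \<in> homset C B W. \<forall>v \<in> homset C A' W. u \<circ>\<^bsub>C\<^esub> i = v \<circ>\<^bsub>C\<^esub> a \<longrightarrow>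
        (\<exists>!w. w \<in> homset C B' W \<and> w \<circ>\<^bsub>C\<^esub> b = u \<and> w \<circ>\<^bsub>C\<^esub> i' = v))"

definition is_pullback ::
  "('o, 'm, 'k, 'x) lincat_scheme \<Rightarrow> 'o \<Rightarrow> 'o \<Rightarrow> 'o \<Rightarrow> 'o \<Rightarrow> 'm \<Rightarrow> 'm \<Rightarrow> 'm \<Rightarrow> 'm \<Rightarrow> bool" where
  "is_pullback C B Z B' Z' p c p' b \<longleftrightarrow>
     composable C B' B Z b p \<and> composable C B' Z' Z p' c \<and> p \<circ>\<^bsub>C\<^esub> b = c \<circ>\<^bsub>C\<^esub> p' \<and>
     (\<forall>W \<in> obj C. \<forall>u \<in> homset C W B. \<forall>v \<in> homset C W Z'. p \<circ>\<^bsub>C\<^esub> u = c \<circ>\<^bsub>C\<^esub> v \<longrightarrow>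
        (\<exists>!w. w \<in> homset C W B' \<and> b \<circ>\<^bsub>C\<^esub> w = u \<and> p' \<circ>\<^bsub>C\<^esub> w = v))"

text \<open>Exact categories in the sense of Quillen.\<close>

locale exact_category = additive_category K E
  for K :: "('k, 'z) ring_scheme" and E :: "('o, 'm, 'k, 'x) exactcat_scheme" +
  assumes confl_typed: "(i, p) \<in> confl E \<Longrightarrow> \<exists>A B Z. composable E A B Z i p"
    and confl_kernel: "exact_seq E A B Z i p \<Longrightarrow> is_kernel E A B Z i p"
    and confl_cokernel: "exact_seq E A B Z i p \<Longrightarrow> is_cokernel E A B Z i p"
    and confl_iso: "\<lbrakk>exact_seq E A B Z i p; composable E A' B' Z' i' p';
        isomorphism E A A' a; isomorphism E B B' b; isomorphism E Z Z' c;
        b \<circ>\<^bsub>E\<^esub> i = i' \<circ>\<^bsub>E\<^esub> a; c \<circ>\<^bsub>E\<^esub> p = p' \<circ>\<^bsub>E\<^esub> b\<rbrakk> \<Longrightarrow> (i', p') \<in> confl E"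
    and adm_mono_ident: "X \<in> obj E \<Longrightarrow> adm_mono E X X (ident E X)"
    and adm_epi_ident: "X \<in> obj E \<Longrightarrow> adm_epi E X X (ident E X)"
    and adm_mono_comp: "\<lbrakk>adm_mono E X Y i; adm_mono E Y Z j\<rbrakk> \<Longrightarrow> adm_mono E X Z (j \<circ>\<^bsub>E\<^esub> i)"
    and adm_epi_comp: "\<lbrakk>adm_epi E X Y p; adm_epi E Y Z q\<rbrakk> \<Longrightarrow> adm_epi E X Z (q \<circ>\<^bsub>E\<^esub> p)"
    and adm_mono_pushout: "\<lbrakk>adm_mono E A B i; A' \<in> obj E; a \<in> homset E A A'\<rbrakk>
        \<Longrightarrow> \<exists>B' i' b. is_pushout E A B A' B' i a i' b \<and> adm_mono E A' B' i'"
    and adm_epi_pullback: "\<lbrakk>adm_epi E B Z p; Z' \<in> obj E; c \<in> homset E Z' Z\<rbrakk>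
        \<Longrightarrow> \<exists>B' p' b. is_pullback E B Z B' Z' p c p' b \<and> adm_epi E B' Z' p'"

text \<open>
  An exact category as an extriangulated category: extensions are equivalence classes of
  conflations, the actions are given by pushout and pullback of conflations (a conflation is
  the pushout along \<open>a\<close> of another one precisely if there is a morphism between them with
  first component \<open>a\<close> and last component an identity, and dually), the addition is the Baer sum
  \<open>\<delta> + \<delta>' = \<nabla>\<^sub>* \<Delta>\<^sup>* (\<delta> \<oplus> \<delta>')\<close>, and every class realises itself.
\<close>

definition yo_push ::
  "('o, 'm, 'k, 'x) exactcat_scheme \<Rightarrow> 'o \<Rightarrow> 'm \<Rightarrow> ('m \<times> 'm) set \<Rightarrow> ('m \<times> 'm) set" where
  "yo_push E X a \<delta> = {(i', p'). \<exists>Y Y' B B' b. \<exists>(i, p) \<in> \<delta>.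
     exact_seq E Y B X i p \<and> exact_seq E Y' B' X i' p' \<and>
     a \<in> homset E Y Y' \<and> b \<in> homset E B B' \<and>
     b \<circ>\<^bsub>E\<^esub> i = i' \<circ>\<^bsub>E\<^esub> a \<and> p' \<circ>\<^bsub>E\<^esub> b = p}"

definition yo_pull ::
  "('o, 'm, 'k, 'x) exactcat_scheme \<Rightarrow> 'o \<Rightarrow> 'm \<Rightarrow> ('m \<times> 'm) set \<Rightarrow> ('m \<times> 'm) set" where
  "yo_pull E Y c \<delta> = {(i', p'). \<exists>X X' B B' b. \<exists>(i, p) \<in> \<delta>.
     exact_seq E Y B X i p \<and> exact_seq E Y B' X' i' p' \<and>
     c \<in> homset E X' X \<and> b \<in> homset E B' B \<and>
     b \<circ>\<^bsub>E\<^esub> i' = i \<and> p \<circ>\<^bsub>E\<^esub> b = c \<circ>\<^bsub>E\<^esub> p'}"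

definition baer_sum ::
  "('o, 'm, 'k, 'x) exactcat_scheme \<Rightarrow> 'o \<Rightarrow> 'o \<Rightarrow> ('m \<times> 'm) set \<Rightarrow> ('m \<times> 'm) set
     \<Rightarrow> ('m \<times> 'm) set" where
  "baer_sum E X Y \<delta> \<delta>' = {s. \<exists>B B' YS iY iY' pY pY' BS iB iB' pB pB' XS iX iX' pX pX'.
     \<exists>(i, p) \<in> \<delta>. \<exists>(i', p') \<in> \<delta>'.
       exact_seq E Y B X i p \<and> exact_seq E Y B' X i' p' \<and>
       biproduct E Y Y YS iY iY' pY pY' \<and> biproduct E B B' BS iB iB' pB pB' \<and>
       biproduct E X X XS iX iX' pX pX' \<and>
       s \<in> yo_push E X (pY \<oplus>\<^bsub>Hom E YS Y\<^esub> pY')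
             (yo_pull E YS (iX \<oplus>\<^bsub>Hom E X XS\<^esub> iX')
               {(mor_sum E YS pY pY' BS iB iB' i i', mor_sum E BS pB pB' XS iX iX' p p')})}"

definition yo_Ext ::
  "('o, 'm, 'k, 'x) exactcat_scheme \<Rightarrow> 'o \<Rightarrow> 'o \<Rightarrow> ('k, ('m \<times> 'm) set) module" where
  "yo_Ext E X Y =
     \<lparr>carrier = {{s. seq_equiv E Y X (i, p) s} | i p. \<exists>B. exact_seq E Y B X i p},
      monoid.mult = undefined, monoid.one = undefined,
      ring.zero = {(i1, p2) | i1 p2. \<exists>S i2 p1. biproduct E Y X S i1 i2 p1 p2},
      ring.add = baer_sum E X Y,
      smult = (\<lambda>k \<delta>. yo_push E X (k \<odot>\<^bsub>Hom E Y Y\<^esub> ident E Y) \<delta>)\<rparr>"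

definition extcat_of_exact ::
  "('o, 'm, 'k) exactcat \<Rightarrow> ('o, 'm, 'k, ('m \<times> 'm) set) extcat" where
  "extcat_of_exact E = \<lparr>obj = obj E, Hom = Hom E, ident = ident E, mcomp = mcomp E,
     Ext = yo_Ext E, push = yo_push E, pull = yo_pull E, realise = (\<lambda>X Y \<delta>. \<delta>)\<rparr>"


section \<open>Algebraic extriangulated categories\<close>

definition extriangulated_equivalence ::
  "('k, 'z) ring_scheme \<Rightarrow> ('o, 'm, 'k, 'e, 'x) extcat_scheme
     \<Rightarrow> ('p, 'n, 'k, 'f, 'y) extcat_scheme
     \<Rightarrow> ('o \<Rightarrow> 'p) \<Rightarrow> ('m \<Rightarrow> 'n) \<Rightarrow> ('o \<Rightarrow> 'o \<Rightarrow> 'e \<Rightarrow> 'f) \<Rightarrow> bool" where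
  "extriangulated_equivalence K D C F M \<Gamma> \<longleftrightarrow>
     F \<in> obj D \<rightarrow> obj C \<and>
     (\<forall>X \<in> obj D. \<forall>Y \<in> obj D. linear_iso K (Hom D X Y) (Hom C (F X) (F Y)) M) \<and>
     (\<forall>X \<in> obj D. M (ident D X) = ident C (F X)) \<and>
     (\<forall>X \<in> obj D. \<forall>Y \<in> obj D. \<forall>Z \<in> obj D. \<forall>f \<in> homset D X Y. \<forall>g \<in> homset D Y Z.
        M (g \<circ>\<^bsub>D\<^esub> f) = M g \<circ>\<^bsub>C\<^esub> M f) \<and>
     (\<forall>Z \<in> obj C. \<exists>X \<in> obj D. \<exists>f. isomorphism C (F X) Z f) \<and>
     (\<forall>X \<in> obj D. \<forall>Y \<in> obj D. linear_iso K (Ext D X Y) (Ext C (F X) (F Y)) (\<Gamma> X Y)) \<and>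
     (\<forall>X \<in> obj D. \<forall>Y \<in> obj D. \<forall>Y' \<in> obj D. \<forall>a \<in> homset D Y Y'. \<forall>\<delta> \<in> carrier (Ext D X Y).
        \<Gamma> X Y' (push D X a \<delta>) = push C (F X) (M a) (\<Gamma> X Y \<delta>)) \<and>
     (\<forall>X \<in> obj D. \<forall>X' \<in> obj D. \<forall>Y \<in> obj D. \<forall>c \<in> homset D X' X. \<forall>\<delta> \<in> carrier (Ext D X Y).
        \<Gamma> X' Y (pull D Y c \<delta>) = pull C (F Y) (M c) (\<Gamma> X Y \<delta>)) \<and>
     (\<forall>X \<in> obj D. \<forall>Y \<in> obj D. \<forall>\<delta> \<in> carrier (Ext D X Y). \<forall>(x, y) \<in> realise D X Y \<delta>.
        (M x, M y) \<in> realise C (F X) (F Y) (\<Gamma> X Y \<delta>))"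

text \<open>
  The objects and morphisms of the exact category may live in arbitrary types, which are
  parameters of the notion because one cannot quantify existentially over types.
\<close>

definition algebraic ::
  "('p \<times> 'q) itself \<Rightarrow> ('k, 'z) ring_scheme \<Rightarrow> ('o, 'm, 'k, 'e, 'x) extcat_scheme \<Rightarrow> bool" where
  "algebraic (_ :: ('p \<times> 'q) itself) K C \<longleftrightarrow>
     (\<exists>(E :: ('p, 'q, 'k) exactcat) P F M \<Gamma>.
        exact_category K E \<and> additively_closed E P \<and>
        P \<subseteq> projectives (extcat_of_exact E) \<inter> injectives (extcat_of_exact E) \<and>
        extriangulated_equivalence K (quot_extcat (extcat_of_exact E) P) C F M \<Gamma>)"


section \<open>Stable categories and the Calabi--Yau property\<close>

abbreviation stable :: "('o, 'm, 'k, 'e, 'x) extcat_scheme \<Rightarrow> ('o, 'm set, 'k, 'e) extcat" where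
  "stable C \<equiv> quot_extcat C (projectives C)"

text \<open>
  A choice of suspension: for each object \<open>X\<close> an extension \<open>\<epsilon> X\<close> with realisation
  \<open>X \<rightarrow> I \<rightarrow> Sg X\<close>, where \<open>I\<close> is injective. The image under the suspension functor of the class
  of \<open>f : X \<rightarrow> Y\<close> is the class of those \<open>h : Sg X \<rightarrow> Sg Y\<close> for which \<open>(f, h)\<close> is a morphism of
  extensions from \<open>\<epsilon> X\<close> to \<open>\<epsilon> Y\<close>; the set of these \<open>h\<close> is a single congruence class.
\<close>

definition is_suspension ::
  "('o, 'm, 'k, 'e, 'x) extcat_scheme \<Rightarrow> ('o \<Rightarrow> 'o) \<Rightarrow> ('o \<Rightarrow> 'e) \<Rightarrow> bool" where
  "is_suspension C Sg \<epsilon> \<longleftrightarrow>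
     (\<forall>X \<in> obj C. \<exists>I \<in> injectives C. \<exists>x y. etriangle C X I (Sg X) x y (\<epsilon> X))"

definition susp_map ::
  "('o, 'm, 'k, 'e, 'x) extcat_scheme \<Rightarrow> ('o \<Rightarrow> 'o) \<Rightarrow> ('o \<Rightarrow> 'e) \<Rightarrow> 'o \<Rightarrow> 'o \<Rightarrow> 'm set \<Rightarrow> 'm set" where
  "susp_map C Sg \<epsilon> X Y A =
     {h \<in> homset C (Sg X) (Sg Y). \<exists>f \<in> A. push C (Sg X) f (\<epsilon> X) = pull C Y h (\<epsilon> Y)}"

definition stably_hom_finite ::
  "('k, 'z) ring_scheme \<Rightarrow> ('o, 'm, 'k, 'e, 'x) extcat_scheme \<Rightarrow> bool" where
  "stably_hom_finite K C \<longleftrightarrow>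
     (\<forall>X \<in> obj C. \<forall>Y \<in> obj C. finite_dimensional K (Hom (stable C) X Y))"

definition stably_2_calabi_yau ::
  "('k, 'z) ring_scheme \<Rightarrow> ('o, 'm, 'k, 'e, 'x) extcat_scheme \<Rightarrow> bool" where
  "stably_2_calabi_yau K C \<longleftrightarrow>
     (\<exists>Sg \<epsilon> \<phi>. is_suspension C Sg \<epsilon> \<and>
        (\<forall>X \<in> obj C. \<forall>Y \<in> obj C.
           linear_iso K (Hom (stable C) X Y)
             (dual_space K (Hom (stable C) Y (Sg (Sg X)))) (\<phi> X Y)) \<and>
        (\<forall>X \<in> obj C. \<forall>X' \<in> obj C. \<forall>Y \<in> obj C. \<forall>Y' \<in> obj C.
           \<forall>f \<in> homset (stable C) X' X. \<forall>g \<in> homset (stable C) Y Y'.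
           \<forall>h \<in> homset (stable C) X Y. \<forall>u \<in> homset (stable C) Y' (Sg (Sg X')).
             \<phi> X' Y' (g \<circ>\<^bsub>stable C\<^esub> h \<circ>\<^bsub>stable C\<^esub> f) u =
             \<phi> X Y h (susp_map C Sg \<epsilon> (Sg X') (Sg X) (susp_map C Sg \<epsilon> X' X f)
                        \<circ>\<^bsub>stable C\<^esub> u \<circ>\<^bsub>stable C\<^esub> g)))"


section \<open>Cluster-tilting subcategories and cluster categories\<close>

text \<open>Full subcategories are given by their sets of objects.\<close>

definition right_approximation ::
  "('o, 'm, 'k, 'x) lincat_scheme \<Rightarrow> 'o set \<Rightarrow> 'o \<Rightarrow> 'o \<Rightarrow> 'm \<Rightarrow> bool" where
  "right_approximation C T T0 X r \<longleftrightarrow> T0 \<in> T \<and> r \<in> homset C T0 X \<and>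
     (\<forall>T1 \<in> T. \<forall>f \<in> homset C T1 X. \<exists>g \<in> homset C T1 T0. f = r \<circ>\<^bsub>C\<^esub> g)"

definition left_approximation ::
  "('o, 'm, 'k, 'x) lincat_scheme \<Rightarrow> 'o set \<Rightarrow> 'o \<Rightarrow> 'o \<Rightarrow> 'm \<Rightarrow> bool" where
  "left_approximation C T X T0 l \<longleftrightarrow> T0 \<in> T \<and> l \<in> homset C X T0 \<and>
     (\<forall>T1 \<in> T. \<forall>f \<in> homset C X T1. \<exists>g \<in> homset C T0 T1. f = g \<circ>\<^bsub>C\<^esub> l)"

definition cluster_tilting :: "('o, 'm, 'k, 'e, 'x) extcat_scheme \<Rightarrow> 'o set \<Rightarrow> bool" where
  "cluster_tilting C T \<longleftrightarrow>
     T = {X \<in> obj C. \<forall>V \<in> T. carrier (Ext C V X) = {\<zero>\<^bsub>Ext C V X\<^esub>}} \<and>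
     T = {X \<in> obj C. \<forall>V \<in> T. carrier (Ext C X V) = {\<zero>\<^bsub>Ext C X V\<^esub>}} \<and>
     (\<forall>X \<in> obj C. \<exists>T0 l. left_approximation C T X T0 l \<and> inflation C X T0 l) \<and>
     (\<forall>X \<in> obj C. \<exists>T0 r. right_approximation C T T0 X r \<and> deflation C T0 X r)"

definition cluster_category ::
  "('p \<times> 'q) itself \<Rightarrow> ('k, 'z) ring_scheme \<Rightarrow> ('o, 'm, 'k, 'e, 'x) extcat_scheme \<Rightarrow> bool" where
  "cluster_category tp K C \<longleftrightarrow>
     extriangulated_category K C \<and> idempotent_complete C \<and> algebraic tp K C \<and> frobenius C \<and>
     (\<exists>T. cluster_tilting C T) \<and> stably_hom_finite K C \<and> stably_2_calabi_yau K C"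


section \<open>Grothendieck groups, index and coindex\<close>

definition K0_relations :: "('o, 'm, 'k, 'x) lincat_scheme \<Rightarrow> 'o set \<Rightarrow> ('o \<Rightarrow>\<^sub>0 int) set" where
  "K0_relations C T = {frag_of S - frag_of X - frag_of Y | S X Y.
     S \<in> T \<and> X \<in> T \<and> Y \<in> T \<and> (\<exists>i1 i2 p1 p2. biproduct C X Y S i1 i2 p1 p2)}"

definition K0_kernel :: "('o, 'm, 'k, 'x) lincat_scheme \<Rightarrow> 'o set \<Rightarrow> ('o \<Rightarrow>\<^sub>0 int) set" where
  "K0_kernel C T = generate (free_Abelian_group T) (K0_relations C T)"

text \<open>The group operation of this group is written multiplicatively.\<close>

definition K0 :: "('o, 'm, 'k, 'x) lincat_scheme \<Rightarrow> 'o set \<Rightarrow> ('o \<Rightarrow>\<^sub>0 int) set monoid" where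
  "K0 C T = free_Abelian_group T Mod K0_kernel C T"

definition K0_class :: "('o, 'm, 'k, 'x) lincat_scheme \<Rightarrow> 'o set \<Rightarrow> 'o \<Rightarrow> ('o \<Rightarrow>\<^sub>0 int) set" where
  "K0_class C T X = K0_kernel C T #>\<^bsub>free_Abelian_group T\<^esub> frag_of X"

definition index :: "('o, 'm, 'k, 'e, 'x) extcat_scheme \<Rightarrow> 'o set \<Rightarrow> 'o \<Rightarrow> ('o \<Rightarrow>\<^sub>0 int) set" where
  "index C T X = (THE g. \<exists>A \<in> T. \<exists>R \<in> T. \<exists>x y. conflation C A R X x y \<and>
     g = K0_class C T R \<otimes>\<^bsub>K0 C T\<^esub> inv\<^bsub>K0 C T\<^esub> K0_class C T A)"

definition coindex :: "('o, 'm, 'k, 'e, 'x) extcat_scheme \<Rightarrow> 'o set \<Rightarrow> 'o \<Rightarrow> ('o \<Rightarrow>\<^sub>0 int) set" where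
  "coindex C T X = (THE g. \<exists>L \<in> T. \<exists>Z \<in> T. \<exists>x y. conflation C X L Z x y \<and>
     g = K0_class C T L \<otimes>\<^bsub>K0 C T\<^esub> inv\<^bsub>K0 C T\<^esub> K0_class C T Z)"

text \<open>\<open>index_hom C U T\<close> and \<open>coindex_hom C U T\<close> are the maps from \<open>K0 C U\<close> to \<open>K0 C T\<close>.\<close>

definition index_hom ::
  "('o, 'm, 'k, 'e, 'x) extcat_scheme \<Rightarrow> 'o set \<Rightarrow> 'o set \<Rightarrow> ('o \<Rightarrow>\<^sub>0 int) set \<Rightarrow> ('o \<Rightarrow>\<^sub>0 int) set" where
  "index_hom C U T = (THE h. h \<in> hom (K0 C U) (K0 C T) \<and> h \<in> extensional (carrier (K0 C U)) \<and>
     (\<forall>V \<in> U. h (K0_class C U V) = index C T V))"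

definition coindex_hom ::
  "('o, 'm, 'k, 'e, 'x) extcat_scheme \<Rightarrow> 'o set \<Rightarrow> 'o set \<Rightarrow> ('o \<Rightarrow>\<^sub>0 int) set \<Rightarrow> ('o \<Rightarrow>\<^sub>0 int) set" where
  "coindex_hom C U T = (THE h. h \<in> hom (K0 C U) (K0 C T) \<and> h \<in> extensional (carrier (K0 C U)) \<and>
     (\<forall>V \<in> U. h (K0_class C U V) = coindex C T V))"

end

theory Submission
  imports Defs
begin

text \<open>
  Take \<open>X\<close> in \<open>T\<close> and a conflation \<open>A \<rightarrow> R \<rightarrow> X\<close> with \<open>A\<close> and \<open>R\<close> in \<open>U\<close>, so that the index of \<open>X\<close> with
  respect to \<open>U\<close> is \<open>[R] - [A]\<close>. The coindex with respect to \<open>T\<close> need not be additive on all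
  conflations, but it is additive on those whose right end \<open>X\<close> lies in \<open>T\<close>, where it takes the value
  \<open>[X]\<close> at that end. Hence \<open>coind [R] - coind [A] = [X]\<close>, that is, the coindex undoes the index
  (\<open>coindex_index\<close>). The statement in the other order is the same statement in the opposite
  category, where the two invariants change places (\<open>index_coindex\<close>).

  Everything thus rests on the restricted additivity of the index (\<open>index_conflation\<close>, and dually
  \<open>coindex_conflation\<close>) and on its independence of the resolution (\<open>resolution_class_unique\<close>). Both
  follow from one construction (\<open>common_extension\<close>), a substitute for the pullback of two deflations:
  triangles \<open>A1 \<rightarrow> B1 \<rightarrow> Z\<close> and \<open>A2 \<rightarrow> B2 \<rightarrow> Z\<close> have an object \<open>M\<close> in common that lies in conflations
  \<open>A1 \<rightarrow> M \<rightarrow> B2\<close> and \<open>A2 \<rightarrow> M \<rightarrow> B1\<close>, up to isomorphism of the right ends. As soon as the ends of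
  one of these conflations lie in the rigid subcategory, it splits, so \<open>M\<close> lies in the subcategory
  as well and its class in the Grothendieck group is known. Existence of resolutions follows from
  the approximations and the exact sequence relating Hom to Ext (\<open>resolution_exists\<close>), and the
  extension from objects to homomorphisms from the universal property of the split Grothendieck
  group (\<open>K0_the_hom\<close>).
\<close>

section \<open>The split Grothendieck group and its universal property\<close>

lemma K0_relations_subset: "K0_relations C T \<subseteq> carrier (free_Abelian_group T)"
  unfolding K0_relations_def
proof clarsimp
  fix S X Y i assume "S \<in> T" "X \<in> T" "Y \<in> T"
    and i: "i \<in> Poly_Mapping.keys (frag_of S - frag_of X - frag_of Y)"
  then show "i \<in> T"
    using keys_diff[of "frag_of S - frag_of X" "frag_of Y"] keys_diff[of "frag_of S" "frag_of X"]
    by (auto simp: keys_frag_of split: if_splits)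
qed

lemma K0_kernel_normal: "K0_kernel C T \<lhd> free_Abelian_group T"
proof -
  interpret comm_group "free_Abelian_group T" by (rule abelian_free_Abelian_group)
  show ?thesis
    unfolding K0_kernel_def
    by (intro subgroup_imp_normal generate_is_subgroup K0_relations_subset)
qed

lemma K0_comm_group: "comm_group (K0 C T)"
proof -
  interpret comm_group "free_Abelian_group T" by (rule abelian_free_Abelian_group)
  show ?thesis
    unfolding K0_def by (intro abelian_FactGroup normal_imp_subgroup K0_kernel_normal)
qed

lemma K0_class_closed: "X \<in> T \<Longrightarrow> K0_class C T X \<in> carrier (K0 C T)"
  unfolding K0_class_def K0_def carrier_FactGroup by auto

lemma K0_projection_hom:
  "(\<lambda>a. K0_kernel C T #>\<^bsub>free_Abelian_group T\<^esub> a) \<in> hom (free_Abelian_group T) (K0 C T)"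
  unfolding K0_def by (rule normal.r_coset_hom_Mod[OF K0_kernel_normal])

lemma K0_class_biproduct:
  assumes "biproduct C X Y S i1 i2 p1 p2" "S \<in> T" "X \<in> T" "Y \<in> T"
  shows "K0_class C T S = K0_class C T X \<otimes>\<^bsub>K0 C T\<^esub> K0_class C T Y"
proof -
  let ?F = "free_Abelian_group T"
  interpret F: comm_group ?F by (rule abelian_free_Abelian_group)
  have sub: "subgroup (K0_kernel C T) ?F"
    by (intro normal_imp_subgroup K0_kernel_normal)
  have rel: "frag_of S - frag_of X - frag_of Y \<in> K0_kernel C T"
    unfolding K0_kernel_def K0_relations_def by (intro generate.incl) (use assms in blast)
  have XY: "frag_of X + frag_of Y \<in> carrier ?F"
    using F.m_closed[of "frag_of X" "frag_of Y"] assms by simp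
  have "K0_class C T S = K0_kernel C T #>\<^bsub>?F\<^esub> (frag_of X + frag_of Y)"
    unfolding K0_class_def
  proof (rule F.repr_independence[symmetric, OF _ XY sub])
    \<comment> \<open>The defining relation translates \<open>[X] + [Y]\<close> to \<open>[S]\<close>, so both lie in one coset.\<close>
    have "frag_of S = (frag_of S - frag_of X - frag_of Y) \<otimes>\<^bsub>?F\<^esub> (frag_of X + frag_of Y)"
      by simp
    then show "frag_of S \<in> K0_kernel C T #>\<^bsub>?F\<^esub> (frag_of X + frag_of Y)"
      using rel unfolding r_coset_def by blast
  qed
  also have "\<dots> = K0_class C T X \<otimes>\<^bsub>K0 C T\<^esub> K0_class C T Y"
    using hom_mult[OF K0_projection_hom, of "frag_of X" T "frag_of Y" C] assms
    by (simp add: K0_class_def)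
  finally show ?thesis .
qed

text \<open>
  The group \<open>K0 C T\<close> is generated by the classes of objects, because the free Abelian group is
  generated by its basis.
\<close>

lemma K0_hom_eqI:
  assumes "group G" "h \<in> hom (K0 C T) G" "h' \<in> hom (K0 C T) G"
    and eq: "\<And>X. X \<in> T \<Longrightarrow> h (K0_class C T X) = h' (K0_class C T X)"
    and g: "g \<in> carrier (K0 C T)"
  shows "h g = h' g"
proof -
  let ?q = "\<lambda>a. K0_kernel C T #>\<^bsub>free_Abelian_group T\<^esub> a"
  interpret h: group_hom "K0 C T" G h
    using assms comm_group.axioms(2)[OF K0_comm_group[of C T]]
    by (simp add: group_hom_def group_hom_axioms_def)
  interpret h': group_hom "K0 C T" G h'
    using assms comm_group.axioms(2)[OF K0_comm_group[of C T]]
    by (simp add: group_hom_def group_hom_axioms_def)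
  interpret q: group_hom "free_Abelian_group T" "K0 C T" ?q
    using K0_projection_hom h.G.group_axioms by (simp add: group_hom_def group_hom_axioms_def)
  obtain a where a: "a \<in> carrier (free_Abelian_group T)" "g = ?q a"
    using g unfolding K0_def carrier_FactGroup by auto
  have "h (?q a) = h' (?q a)"
  proof (rule free_Abelian_group_induct[where x = a and S = T])
    show "Poly_Mapping.keys a \<subseteq> T"
      using a by simp
    show "h (?q 0) = h' (?q 0)"
      using q.hom_one by simp
    show "h (?q (frag_of X)) = h' (?q (frag_of X))" if "X \<in> T" for X
      using eq[OF that] by (simp add: K0_class_def)
    fix b c
    assume keys: "Poly_Mapping.keys b \<subseteq> T" "Poly_Mapping.keys c \<subseteq> T"
      and IH: "h (?q b) = h' (?q b)" "h (?q c) = h' (?q c)"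
    have car: "b \<in> carrier (free_Abelian_group T)" "c \<in> carrier (free_Abelian_group T)"
      using keys by auto
    have "?q (b - c) = ?q b \<otimes>\<^bsub>K0 C T\<^esub> inv\<^bsub>K0 C T\<^esub> ?q c"
      using q.hom_mult[of b "- c"] q.hom_inv[of c] car keys by simp
    then show "h (?q (b - c)) = h' (?q (b - c))"
      using IH q.hom_closed[OF car(1)] q.hom_closed[OF car(2)]
      by (simp add: h.hom_mult h'.hom_mult h.hom_inv h'.hom_inv)
  qed
  then show ?thesis by (simp add: a)
qed

text \<open>
  The universal property of \<open>K0 C T\<close>: a function additive on biproducts extends to the free Abelian
  group on \<open>T\<close>, and the extension kills the defining relations.
\<close>

lemma K0_hom_exists:
  assumes G: "comm_group G" and f: "f \<in> T \<rightarrow> carrier G"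
    and add: "\<And>X Y S i1 i2 p1 p2. \<lbrakk>X \<in> T; Y \<in> T; S \<in> T; biproduct C X Y S i1 i2 p1 p2\<rbrakk>
      \<Longrightarrow> f S = f X \<otimes>\<^bsub>G\<^esub> f Y"
  obtains h where "h \<in> hom (K0 C T) G" "\<And>X. X \<in> T \<Longrightarrow> h (K0_class C T X) = f X"
proof -
  interpret G: comm_group G by (rule G)
  let ?F = "free_Abelian_group T"
  obtain h where h: "h \<in> hom ?F G" "\<And>X. X \<in> T \<Longrightarrow> h (frag_of X) = f X"
    using G.free_Abelian_group_universal[of f T] f by blast
  interpret h: group_hom ?F G h
    using h by (simp add: group_hom_def group_hom_axioms_def)
  have "K0_relations C T \<subseteq> kernel ?F G h"
  proof
    fix r assume r: "r \<in> K0_relations C T"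
    then obtain S X Y i1 i2 p1 p2 where rel: "r = frag_of S - frag_of X - frag_of Y"
      "S \<in> T" "X \<in> T" "Y \<in> T" "biproduct C X Y S i1 i2 p1 p2"
      unfolding K0_relations_def by blast
    have rF: "r \<in> carrier ?F"
      using r K0_relations_subset by blast
    have "frag_of S = r \<otimes>\<^bsub>?F\<^esub> (frag_of X \<otimes>\<^bsub>?F\<^esub> frag_of Y)"
      by (simp add: rel)
    then have "f S = h r \<otimes>\<^bsub>G\<^esub> (f X \<otimes>\<^bsub>G\<^esub> f Y)"
      using h.hom_mult rF rel h(2) h.G.m_closed frag_of_in_free_Abelian_group
      by metis
    moreover have "f S = f X \<otimes>\<^bsub>G\<^esub> f Y" "f S \<in> carrier G"
      using add rel f by auto
    ultimately have "h r = \<one>\<^bsub>G\<^esub>"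
      by (metis G.l_cancel_one G.m_comm G.r_cancel_one h.hom_closed rF)
    then show "r \<in> kernel ?F G h"
      using rF by (simp add: kernel_def)
  qed
  then have "K0_kernel C T \<subseteq> kernel ?F G h"
    unfolding K0_kernel_def by (intro h.generate_subgroup_incl h.subgroup_kernel)
  with h.FactGroup_universal_kernel[OF K0_kernel_normal] obtain g
    where "g \<in> hom (K0 C T) G" "\<And>x. x \<in> carrier ?F \<Longrightarrow> g (K0_kernel C T #>\<^bsub>?F\<^esub> x) = h x"
    unfolding K0_def by metis
  then show thesis
    using that[of g] h(2) by (simp add: K0_class_def)
qed

text \<open>
  \<open>index_hom\<close> and \<open>coindex_hom\<close> are definite descriptions of this form; restricting an extension to
  the carrier makes it unique as a function on the whole type.
\<close>

lemma K0_the_hom: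
  assumes G: "comm_group G" and f: "f \<in> T \<rightarrow> carrier G"
    and add: "\<And>X Y S i1 i2 p1 p2. \<lbrakk>X \<in> T; Y \<in> T; S \<in> T; biproduct C X Y S i1 i2 p1 p2\<rbrakk>
      \<Longrightarrow> f S = f X \<otimes>\<^bsub>G\<^esub> f Y"
  defines "H \<equiv> THE h. h \<in> hom (K0 C T) G \<and> h \<in> extensional (carrier (K0 C T)) \<and>
     (\<forall>X \<in> T. h (K0_class C T X) = f X)"
  shows "H \<in> hom (K0 C T) G" and "\<And>X. X \<in> T \<Longrightarrow> H (K0_class C T X) = f X"
proof -
  obtain h where h: "h \<in> hom (K0 C T) G" "\<And>X. X \<in> T \<Longrightarrow> h (K0_class C T X) = f X"
    using add by (rule K0_hom_exists[where C = C, OF G f]) blast+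
  let ?P = "\<lambda>h. h \<in> hom (K0 C T) G \<and> h \<in> extensional (carrier (K0 C T)) \<and>
     (\<forall>X \<in> T. h (K0_class C T X) = f X)"
  have "?P (restrict h (carrier (K0 C T)))"
    using h K0_class_closed[of _ T C] group.is_monoid[OF comm_group.axioms(2)[OF K0_comm_group[of C T]]]
    by (auto simp: hom_def monoid.m_closed)
  moreover have "h1 = h2" if "?P h1" "?P h2" for h1 h2
  proof (rule extensionalityI)
    show "h1 \<in> extensional (carrier (K0 C T))" "h2 \<in> extensional (carrier (K0 C T))"
      using that by auto
  qed (rule K0_hom_eqI[OF comm_group.axioms(2)[OF G]], use that in auto)
  ultimately have "\<exists>!h. ?P h" by blast
  from theI'[OF this] show "H \<in> hom (K0 C T) G" "\<And>X. X \<in> T \<Longrightarrow> H (K0_class C T X) = f X"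
    by (auto simp: H_def)
qed

section \<open>Isomorphisms and biproducts in linear categories\<close>

lemma linear_map_zero:
  assumes "abelian_group M" "abelian_group N" "linear_map K M N f"
  shows "f \<zero>\<^bsub>M\<^esub> = \<zero>\<^bsub>N\<^esub>"
proof -
  interpret M: abelian_group M by fact
  interpret N: abelian_group N by fact
  have closed: "f \<zero>\<^bsub>M\<^esub> \<in> carrier N"
    using assms(3) M.zero_closed unfolding linear_map_def by blast
  have "f (\<zero>\<^bsub>M\<^esub> \<oplus>\<^bsub>M\<^esub> \<zero>\<^bsub>M\<^esub>) = f \<zero>\<^bsub>M\<^esub> \<oplus>\<^bsub>N\<^esub> f \<zero>\<^bsub>M\<^esub>"
    using assms(3) M.zero_closed unfolding linear_map_def by blast
  then have "f \<zero>\<^bsub>M\<^esub> \<oplus>\<^bsub>N\<^esub> f \<zero>\<^bsub>M\<^esub> = f \<zero>\<^bsub>M\<^esub>"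
    by simp
  then show ?thesis
    using closed by simp
qed

context linear_category
begin

lemma Hom_abelian_group: "\<lbrakk>X \<in> obj C; Y \<in> obj C\<rbrakk> \<Longrightarrow> abelian_group (Hom C X Y)"
  by (rule module.axioms(2)[OF Hom_module])

lemma zero_mor_closed: "\<lbrakk>X \<in> obj C; Y \<in> obj C\<rbrakk> \<Longrightarrow> \<zero>\<^bsub>Hom C X Y\<^esub> \<in> homset C X Y"
  by (intro abelian_monoid.zero_closed abelian_group.axioms(1) Hom_abelian_group)

lemma comp_zero:
  "\<lbrakk>X \<in> obj C; Y \<in> obj C; Z \<in> obj C; g \<in> homset C Y Z\<rbrakk>
    \<Longrightarrow> g \<circ>\<^bsub>C\<^esub> \<zero>\<^bsub>Hom C X Y\<^esub> = \<zero>\<^bsub>Hom C X Z\<^esub>"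
  using linear_map_zero[OF _ _ comp_linear_right] Hom_abelian_group by blast

lemma zero_comp:
  "\<lbrakk>X \<in> obj C; Y \<in> obj C; Z \<in> obj C; f \<in> homset C X Y\<rbrakk>
    \<Longrightarrow> \<zero>\<^bsub>Hom C Y Z\<^esub> \<circ>\<^bsub>C\<^esub> f = \<zero>\<^bsub>Hom C X Z\<^esub>"
  using linear_map_zero[OF _ _ comp_linear_left] Hom_abelian_group by blast

lemma ident_isomorphism: "X \<in> obj C \<Longrightarrow> isomorphism C X X (ident C X)"
  unfolding isomorphism_def using ident_closed comp_ident by blast

lemma isomorphism_sym:
  assumes "isomorphism C X Y f"
  obtains g where "isomorphism C Y X g"
    "g \<circ>\<^bsub>C\<^esub> f = ident C X" "f \<circ>\<^bsub>C\<^esub> g = ident C Y"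
  using assms unfolding isomorphism_def by blast

lemma isomorphism_trans:
  assumes f: "isomorphism C X Y f" and g: "isomorphism C Y Z g"
  shows "isomorphism C X Z (g \<circ>\<^bsub>C\<^esub> f)"
proof -
  obtain f' where f': "X \<in> obj C" "Y \<in> obj C" "f \<in> homset C X Y" "f' \<in> homset C Y X"
    "f' \<circ>\<^bsub>C\<^esub> f = ident C X" "f \<circ>\<^bsub>C\<^esub> f' = ident C Y"
    using f unfolding isomorphism_def by blast
  obtain g' where g': "Z \<in> obj C" "g \<in> homset C Y Z" "g' \<in> homset C Z Y"
    "g' \<circ>\<^bsub>C\<^esub> g = ident C Y" "g \<circ>\<^bsub>C\<^esub> g' = ident C Z"
    using g unfolding isomorphism_def by blast
  have c: "g \<circ>\<^bsub>C\<^esub> f \<in> homset C X Z" "f' \<circ>\<^bsub>C\<^esub> g' \<in> homset C Z X"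
    using f' g' comp_closed by blast+
  have "(f' \<circ>\<^bsub>C\<^esub> g') \<circ>\<^bsub>C\<^esub> (g \<circ>\<^bsub>C\<^esub> f) = f' \<circ>\<^bsub>C\<^esub> ((g' \<circ>\<^bsub>C\<^esub> g) \<circ>\<^bsub>C\<^esub> f)"
    using comp_assoc[of X Z Y X "g \<circ>\<^bsub>C\<^esub> f" g' f'] comp_assoc[of X Y Z Y f g g'] f' g' c by simp
  moreover have "(g \<circ>\<^bsub>C\<^esub> f) \<circ>\<^bsub>C\<^esub> (f' \<circ>\<^bsub>C\<^esub> g') = g \<circ>\<^bsub>C\<^esub> ((f \<circ>\<^bsub>C\<^esub> f') \<circ>\<^bsub>C\<^esub> g')"
    using comp_assoc[of Z X Y Z "f' \<circ>\<^bsub>C\<^esub> g'" f g] comp_assoc[of Z Y X Y g' f' f] f' g' c by simp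
  ultimately have "(f' \<circ>\<^bsub>C\<^esub> g') \<circ>\<^bsub>C\<^esub> (g \<circ>\<^bsub>C\<^esub> f) = ident C X"
    "(g \<circ>\<^bsub>C\<^esub> f) \<circ>\<^bsub>C\<^esub> (f' \<circ>\<^bsub>C\<^esub> g') = ident C Z"
    using f' g' ident_comp[of X Y f] ident_comp[of Z Y g'] by simp_all
  then show ?thesis
    unfolding isomorphism_def using c f' g' by blast
qed

lemma biproduct_swap:
  assumes "biproduct C X Y S i1 i2 p1 p2"
  shows "biproduct C Y X S i2 i1 p2 p1"
proof -
  have "X \<in> obj C" "Y \<in> obj C" "S \<in> obj C"
    "i1 \<circ>\<^bsub>C\<^esub> p1 \<in> homset C S S" "i2 \<circ>\<^bsub>C\<^esub> p2 \<in> homset C S S"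
    using assms comp_closed unfolding biproduct_def by blast+
  then have "(i2 \<circ>\<^bsub>C\<^esub> p2) \<oplus>\<^bsub>Hom C S S\<^esub> (i1 \<circ>\<^bsub>C\<^esub> p1) = (i1 \<circ>\<^bsub>C\<^esub> p1) \<oplus>\<^bsub>Hom C S S\<^esub> (i2 \<circ>\<^bsub>C\<^esub> p2)"
    using abelian_monoid.a_comm[OF abelian_group.axioms(1)[OF Hom_abelian_group]] by blast
  then show ?thesis
    using assms unfolding biproduct_def by auto
qed

text \<open>
  Every isomorphism \<open>X \<rightarrow> Y\<close> exhibits \<open>Y\<close> as a biproduct of \<open>X\<close> with a zero object. Facts about
  isomorphisms thereby become special cases of facts about biproducts and split extensions.
\<close>

lemma biproduct_zero_right:
  assumes Z: "zero_object C Z" and f: "isomorphism C X Y f"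
  obtains g where "biproduct C X Z Y f \<zero>\<^bsub>Hom C Z Y\<^esub> g \<zero>\<^bsub>Hom C Y Z\<^esub>"
proof -
  obtain g where g: "X \<in> obj C" "Y \<in> obj C" "f \<in> homset C X Y" "g \<in> homset C Y X"
    "g \<circ>\<^bsub>C\<^esub> f = ident C X" "f \<circ>\<^bsub>C\<^esub> g = ident C Y"
    using f unfolding isomorphism_def by blast
  have Z': "Z \<in> obj C" "ident C Z = \<zero>\<^bsub>Hom C Z Z\<^esub>"
    using Z unfolding zero_object_def by auto
  have "ident C Y \<oplus>\<^bsub>Hom C Y Y\<^esub> \<zero>\<^bsub>Hom C Y Y\<^esub> = ident C Y"
    using abelian_monoid.r_zero[OF abelian_group.axioms(1)[OF Hom_abelian_group]] ident_closed g
    by blast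
  then have "biproduct C X Z Y f \<zero>\<^bsub>Hom C Z Y\<^esub> g \<zero>\<^bsub>Hom C Y Z\<^esub>"
    unfolding biproduct_def using g Z' zero_mor_closed comp_zero zero_comp by simp
  then show thesis by (rule that)
qed

lemma biproduct_isomorphic:
  assumes b: "biproduct C X Y S i1 i2 p1 p2" and f: "isomorphism C S S' f"
  obtains j1 j2 q1 q2 where "biproduct C X Y S' j1 j2 q1 q2"
proof -
  obtain g where g: "S \<in> obj C" "S' \<in> obj C" "f \<in> homset C S S'" "g \<in> homset C S' S"
    "g \<circ>\<^bsub>C\<^esub> f = ident C S" "f \<circ>\<^bsub>C\<^esub> g = ident C S'"
    using f unfolding isomorphism_def by blast
  have o: "X \<in> obj C" "Y \<in> obj C"
    and m: "i1 \<in> homset C X S" "i2 \<in> homset C Y S" "p1 \<in> homset C S X" "p2 \<in> homset C S Y"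
    and e: "p1 \<circ>\<^bsub>C\<^esub> i1 = ident C X" "p2 \<circ>\<^bsub>C\<^esub> i2 = ident C Y"
      "p1 \<circ>\<^bsub>C\<^esub> i2 = \<zero>\<^bsub>Hom C Y X\<^esub>" "p2 \<circ>\<^bsub>C\<^esub> i1 = \<zero>\<^bsub>Hom C X Y\<^esub>"
      "(i1 \<circ>\<^bsub>C\<^esub> p1) \<oplus>\<^bsub>Hom C S S\<^esub> (i2 \<circ>\<^bsub>C\<^esub> p2) = ident C S"
    using b unfolding biproduct_def by auto
  \<comment> \<open>The structure maps are conjugated by \<open>f\<close>: inner pairs \<open>g \<circ> f\<close> cancel, outer factors \<open>f\<close> and \<open>g\<close> remain.\<close>
  have mid: "(p \<circ>\<^bsub>C\<^esub> g) \<circ>\<^bsub>C\<^esub> (f \<circ>\<^bsub>C\<^esub> i) = p \<circ>\<^bsub>C\<^esub> i"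
    if "V \<in> obj C" "W \<in> obj C" "p \<in> homset C S V" "i \<in> homset C W S" for p i V W
    using comp_assoc[of W S' S V "f \<circ>\<^bsub>C\<^esub> i" g p] comp_assoc[of W S S' S i f g]
      ident_comp[of W S i] comp_closed[of W S S' i f] that g by simp
  have out: "(f \<circ>\<^bsub>C\<^esub> i) \<circ>\<^bsub>C\<^esub> (p \<circ>\<^bsub>C\<^esub> g) = f \<circ>\<^bsub>C\<^esub> ((i \<circ>\<^bsub>C\<^esub> p) \<circ>\<^bsub>C\<^esub> g)"
    if "V \<in> obj C" "p \<in> homset C S V" "i \<in> homset C V S" for p i V
    using comp_assoc[of S' V S S' "p \<circ>\<^bsub>C\<^esub> g" i f] comp_assoc[of S' S V S g p i]
      comp_closed[of S' S V g p] that g by simp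
  have c: "i1 \<circ>\<^bsub>C\<^esub> p1 \<in> homset C S S" "i2 \<circ>\<^bsub>C\<^esub> p2 \<in> homset C S S"
    using o m g comp_closed by blast+
  have lin: "(f \<circ>\<^bsub>C\<^esub> (u \<circ>\<^bsub>C\<^esub> g)) \<oplus>\<^bsub>Hom C S' S'\<^esub> (f \<circ>\<^bsub>C\<^esub> (v \<circ>\<^bsub>C\<^esub> g)) =
      f \<circ>\<^bsub>C\<^esub> ((u \<oplus>\<^bsub>Hom C S S\<^esub> v) \<circ>\<^bsub>C\<^esub> g)"
    if "u \<in> homset C S S" "v \<in> homset C S S" for u v
    using comp_linear_right[of S' S S' f] comp_linear_left[of S' S S g] comp_closed[of S' S S g] that g
    unfolding linear_map_def by simp
  have cl: "f \<circ>\<^bsub>C\<^esub> i1 \<in> homset C X S'" "f \<circ>\<^bsub>C\<^esub> i2 \<in> homset C Y S'"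
    "p1 \<circ>\<^bsub>C\<^esub> g \<in> homset C S' X" "p2 \<circ>\<^bsub>C\<^esub> g \<in> homset C S' Y"
    using comp_closed[OF o(1) g(1,2) m(1) g(3)] comp_closed[OF o(2) g(1,2) m(2) g(3)]
      comp_closed[OF g(2,1) o(1) g(4) m(3)] comp_closed[OF g(2,1) o(2) g(4) m(4)] by auto
  have sum: "(f \<circ>\<^bsub>C\<^esub> i1) \<circ>\<^bsub>C\<^esub> (p1 \<circ>\<^bsub>C\<^esub> g) \<oplus>\<^bsub>Hom C S' S'\<^esub> (f \<circ>\<^bsub>C\<^esub> i2) \<circ>\<^bsub>C\<^esub> (p2 \<circ>\<^bsub>C\<^esub> g) =
    ident C S'"
    using out[OF o(1) m(3,1)] out[OF o(2) m(4,2)] lin[OF c] e(5) ident_comp[OF g(2,1,4)] g(6)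
    by (simp only:)
  have "biproduct C X Y S' (f \<circ>\<^bsub>C\<^esub> i1) (f \<circ>\<^bsub>C\<^esub> i2) (p1 \<circ>\<^bsub>C\<^esub> g) (p2 \<circ>\<^bsub>C\<^esub> g)"
    unfolding biproduct_def
    by (simp only: cl sum o g(2) e mid[OF o(1) o(1) m(3,1)] mid[OF o(2) o(2) m(4,2)]
        mid[OF o(1) o(2) m(3,2)] mid[OF o(2) o(1) m(4,1)] simp_thms)
  then show thesis by (rule that)
qed

end

section \<open>Exactness and common extensions in extriangulated categories\<close>

context extriangulated_category
begin

lemma Ext_abelian_group: "\<lbrakk>X \<in> obj C; Y \<in> obj C\<rbrakk> \<Longrightarrow> abelian_group (Ext C X Y)"
  by (rule module.axioms(2)[OF Ext_module])

lemma zero_ext_closed: "\<lbrakk>X \<in> obj C; Y \<in> obj C\<rbrakk> \<Longrightarrow> \<zero>\<^bsub>Ext C X Y\<^esub> \<in> carrier (Ext C X Y)"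
  by (intro abelian_monoid.zero_closed abelian_group.axioms(1) Ext_abelian_group)

lemma push_closed:
  "\<lbrakk>X \<in> obj C; Y \<in> obj C; Y' \<in> obj C; a \<in> homset C Y Y'; \<delta> \<in> carrier (Ext C X Y)\<rbrakk>
    \<Longrightarrow> push C X a \<delta> \<in> carrier (Ext C X Y')"
  using push_linear unfolding linear_map_def by blast

lemma pull_closed:
  "\<lbrakk>X \<in> obj C; X' \<in> obj C; Y \<in> obj C; c \<in> homset C X' X; \<delta> \<in> carrier (Ext C X Y)\<rbrakk>
    \<Longrightarrow> pull C Y c \<delta> \<in> carrier (Ext C X' Y)"
  using pull_linear unfolding linear_map_def by blast

lemma push_zero_ext:
  "\<lbrakk>X \<in> obj C; Y \<in> obj C; Y' \<in> obj C; a \<in> homset C Y Y'\<rbrakk>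
    \<Longrightarrow> push C X a \<zero>\<^bsub>Ext C X Y\<^esub> = \<zero>\<^bsub>Ext C X Y'\<^esub>"
  using linear_map_zero[OF _ _ push_linear] Ext_abelian_group by blast

lemma pull_zero_ext:
  "\<lbrakk>X \<in> obj C; X' \<in> obj C; Y \<in> obj C; c \<in> homset C X' X\<rbrakk>
    \<Longrightarrow> pull C Y c \<zero>\<^bsub>Ext C X Y\<^esub> = \<zero>\<^bsub>Ext C X' Y\<^esub>"
  using linear_map_zero[OF _ _ pull_linear] Ext_abelian_group by blast

lemma push_zero_mor:
  "\<lbrakk>X \<in> obj C; Y \<in> obj C; Y' \<in> obj C; \<delta> \<in> carrier (Ext C X Y)\<rbrakk>
    \<Longrightarrow> push C X \<zero>\<^bsub>Hom C Y Y'\<^esub> \<delta> = \<zero>\<^bsub>Ext C X Y'\<^esub>"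
  using linear_map_zero[OF _ _ push_linear_mor] Ext_abelian_group Hom_abelian_group by blast

lemma etriangleD:
  assumes "etriangle C A B Z x y \<delta>"
  shows "A \<in> obj C" "B \<in> obj C" "Z \<in> obj C" "x \<in> homset C A B" "y \<in> homset C B Z"
    "\<delta> \<in> carrier (Ext C Z A)"
  using assms unfolding etriangle_def composable_def by auto

lemma etriangle_exists:
  assumes "X \<in> obj C" "Y \<in> obj C" "\<delta> \<in> carrier (Ext C X Y)"
  obtains B x y where "etriangle C Y B X x y \<delta>"
proof -
  obtain B x y where B: "composable C Y B X x y" "realise C X Y \<delta> = {s. seq_equiv C Y X (x, y) s}"
    using real_class[OF assms] by blast
  have o: "Y \<in> obj C" "B \<in> obj C" "X \<in> obj C" "x \<in> homset C Y B" "y \<in> homset C B X"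
    using B(1) unfolding composable_def by auto
  have "seq_equiv C Y X (x, y) (x, y)"
    unfolding seq_equiv_def fst_conv snd_conv
    using B(1) ident_isomorphism[OF o(2)] ident_comp[OF o(1,2,4)] comp_ident[OF o(2,3,5)] by blast
  then show thesis
    using that[of B x y] B assms(3) unfolding etriangle_def by blast
qed

text \<open>
  All realisations of \<open>\<delta>\<close> are equivalent to one chosen realisation. Since hom-sets are disjoint, the
  middle objects that occur in such an equivalence are the given ones.
\<close>

lemma etriangle_middle_unique:
  assumes t: "etriangle C A B Z x y \<delta>" and t': "etriangle C A B' Z x' y' \<delta>"
  obtains b where "isomorphism C B B' b"
proof -
  note o = etriangleD[OF t] and o' = etriangleD[OF t']
  obtain B0 x0 y0 where B0: "composable C A B0 Z x0 y0"
    "realise C Z A \<delta> = {s. seq_equiv C A Z (x0, y0) s}"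
    using real_class[OF o(3,1,6)] by blast
  have iso: "\<exists>b. isomorphism C B0 B1 b" if t1: "etriangle C A B1 Z x1 y1 \<delta>" for B1 x1 y1
  proof -
    have "seq_equiv C A Z (x0, y0) (x1, y1)"
      using t1 B0 unfolding etriangle_def by blast
    then obtain B2 B3 b where b: "composable C A B2 Z x0 y0" "composable C A B3 Z x1 y1"
      "isomorphism C B2 B3 b"
      unfolding seq_equiv_def by auto
    have "B2 = B0" "B3 = B1"
      using b(1,2) B0(1) etriangleD[OF t1] Hom_disjoint unfolding composable_def by metis+
    then show ?thesis
      using b by blast
  qed
  obtain b b' where "isomorphism C B0 B b" "isomorphism C B0 B' b'"
    using iso t t' by blast
  moreover obtain c where "isomorphism C B B0 c"
    using isomorphism_sym[OF \<open>isomorphism C B0 B b\<close>] by blast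
  ultimately show thesis
    using isomorphism_trans that by blast
qed

lemma biproduct_etriangle:
  assumes "biproduct C A Z S i1 i2 p1 p2"
  shows "etriangle C A S Z i1 p2 \<zero>\<^bsub>Ext C Z A\<^esub>"
  using real_zero[OF assms] assms zero_ext_closed
  unfolding etriangle_def biproduct_def composable_def by blast

text \<open>
  The biproduct sequence realises the zero extension, so any other realisation has a middle term
  isomorphic to the biproduct.
\<close>

lemma split_etriangle:
  assumes t: "etriangle C A B Z x y \<zero>\<^bsub>Ext C Z A\<^esub>"
  obtains i1 i2 p1 p2 where "biproduct C A Z B i1 i2 p1 p2"
proof -
  obtain S i1 i2 p1 p2 where S: "biproduct C A Z S i1 i2 p1 p2"
    using biproduct_exists etriangleD[OF t] by blast
  obtain b where "isomorphism C S B b"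
    using etriangle_middle_unique[OF biproduct_etriangle[OF S] t] by blast
  then show thesis
    using biproduct_isomorphic[OF S] that by blast
qed

lemma iso_etriangle_right:
  assumes "zero_object C Z" "isomorphism C X Y f"
  shows "etriangle C X Y Z f \<zero>\<^bsub>Hom C Y Z\<^esub> \<zero>\<^bsub>Ext C Z X\<^esub>"
  using biproduct_zero_right[OF assms] biproduct_etriangle by metis

text \<open>
  Applied to the inverse isomorphism, the biproduct \<open>X = Y \<oplus> Z\<close> has some retraction \<open>h\<close> as its
  projection to \<open>Y\<close>. A one-sided inverse of an invertible morphism is its inverse, so \<open>h = f\<close>.
\<close>

lemma iso_etriangle_left:
  assumes "zero_object C Z" "isomorphism C X Y f"
  shows "etriangle C Z X Y \<zero>\<^bsub>Hom C Z X\<^esub> f \<zero>\<^bsub>Ext C Y Z\<^esub>"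
proof -
  obtain g where g: "isomorphism C Y X g" "g \<circ>\<^bsub>C\<^esub> f = ident C X" "f \<circ>\<^bsub>C\<^esub> g = ident C Y"
    using isomorphism_sym[OF assms(2)] by blast
  have m: "X \<in> obj C" "Y \<in> obj C" "f \<in> homset C X Y" "g \<in> homset C Y X"
    using assms(2) g(1) unfolding isomorphism_def by auto
  obtain h where h: "biproduct C Y Z X g \<zero>\<^bsub>Hom C Z X\<^esub> h \<zero>\<^bsub>Hom C X Z\<^esub>"
    using biproduct_zero_right[OF assms(1) g(1)] by blast
  then have h': "h \<in> homset C X Y" "h \<circ>\<^bsub>C\<^esub> g = ident C Y"
    unfolding biproduct_def by auto
  have "h = h \<circ>\<^bsub>C\<^esub> (g \<circ>\<^bsub>C\<^esub> f)"
    using comp_ident[OF m(1,2) h'(1)] g(2) by simp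
  also have "\<dots> = (h \<circ>\<^bsub>C\<^esub> g) \<circ>\<^bsub>C\<^esub> f"
    using comp_assoc[OF m(1,2,1,2,3,4) h'(1)] by simp
  also have "\<dots> = f"
    using h'(2) ident_comp[OF m(1-3)] by simp
  finally show ?thesis
    using biproduct_etriangle[OF biproduct_swap[OF h]] by simp
qed

text \<open>
  Two consecutive maps of a triangle compose to zero: \<open>(0, id, y)\<close> is a morphism from the
  split triangle \<open>0 \<rightarrow> B \<rightarrow> B\<close> to the given one, so the pullback of \<open>\<delta>\<close> along \<open>y\<close> is a push-forward of
  an extension by a zero object.
\<close>

lemma pull_deflation_zero:
  assumes t: "etriangle C A B Z x y \<delta>"
  shows "pull C A y \<delta> = \<zero>\<^bsub>Ext C B A\<^esub>"
proof -
  note o = etriangleD[OF t]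
  obtain N where N: "zero_object C N"
    using zero_object_exists by blast
  then have N': "N \<in> obj C"
    unfolding zero_object_def by blast
  have t0: "etriangle C N B B \<zero>\<^bsub>Hom C N B\<^esub> (ident C B) \<zero>\<^bsub>Ext C B N\<^esub>"
    by (intro iso_etriangle_left N ident_isomorphism o)
  have "ident C B \<circ>\<^bsub>C\<^esub> \<zero>\<^bsub>Hom C N B\<^esub> = x \<circ>\<^bsub>C\<^esub> \<zero>\<^bsub>Hom C N A\<^esub>"
    using comp_zero N' o ident_closed by simp
  then obtain c where c: "c \<in> homset C B Z" "c \<circ>\<^bsub>C\<^esub> ident C B = y \<circ>\<^bsub>C\<^esub> ident C B"
    "push C B \<zero>\<^bsub>Hom C N A\<^esub> \<zero>\<^bsub>Ext C B N\<^esub> = pull C A c \<delta>"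
    using ET3[OF t0 t zero_mor_closed[OF N' o(1)] ident_closed[OF o(2)]] by blast
  then have "c = y"
    using comp_ident[OF o(2,3)] o(5) by simp
  then show ?thesis
    using c(3) push_zero_ext[OF o(2) N' o(1) zero_mor_closed[OF N' o(1)]] by simp
qed

text \<open>
  Exactness of \<open>Hom(V, Z) \<rightarrow> Ext(V, A) \<rightarrow> Ext(V, B)\<close>. If \<open>x\<close> kills \<open>\<epsilon>\<close>, then \<open>x\<close> extends over the
  middle term of a realisation of \<open>\<epsilon>\<close>; completing the resulting square to a morphism of triangles
  yields its third component \<open>c\<close>.
\<close>

lemma ext_killed_by_inflation:
  assumes t: "etriangle C A B Z x y \<delta>" and V: "V \<in> obj C" and e: "\<epsilon> \<in> carrier (Ext C V A)"
    and zero: "push C V x \<epsilon> = \<zero>\<^bsub>Ext C V B\<^esub>"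
  obtains c where "c \<in> homset C V Z" "\<epsilon> = pull C A c \<delta>"
proof -
  note o = etriangleD[OF t]
  obtain N where N: "zero_object C N"
    using zero_object_exists by blast
  then have N': "N \<in> obj C"
    unfolding zero_object_def by blast
  obtain M k l where M: "etriangle C A M V k l \<epsilon>"
    using etriangle_exists[OF V o(1) e] by blast
  have t0: "etriangle C B B N (ident C B) \<zero>\<^bsub>Hom C B N\<^esub> \<zero>\<^bsub>Ext C N B\<^esub>"
    by (intro iso_etriangle_right N ident_isomorphism o)
  \<comment> \<open>Comparing with the split triangle \<open>B \<rightarrow> B \<rightarrow> 0\<close> turns the vanishing into an extension of \<open>x\<close> along \<open>k\<close>.\<close>
  have "push C V x \<epsilon> = pull C B \<zero>\<^bsub>Hom C V N\<^esub> \<zero>\<^bsub>Ext C N B\<^esub>"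
    using zero pull_zero_ext[OF N' V o(2) zero_mor_closed[OF V N']] by simp
  then obtain b where b: "b \<in> homset C M B" "b \<circ>\<^bsub>C\<^esub> k = ident C B \<circ>\<^bsub>C\<^esub> x"
    using real_morphism[OF M t0 o(4) zero_mor_closed[OF V N']] by blast
  then have "b \<circ>\<^bsub>C\<^esub> k = x \<circ>\<^bsub>C\<^esub> ident C A"
    using ident_comp[OF o(1,2,4)] comp_ident[OF o(1,2,4)] by simp
  then obtain c where "c \<in> homset C V Z" "push C V (ident C A) \<epsilon> = pull C A c \<delta>"
    using ET3[OF M t ident_closed[OF o(1)] b(1)] by blast
  then show thesis
    using that push_ident[OF V o(1) e] by metis
qed

text \<open>
  This replaces the pullback of two deflations with the same target. If \<open>M\<close> is the middle term of a
  realisation of \<open>i1 \<delta>1 + i2 \<delta>2\<close> in \<open>Ext(Z, A1 \<oplus> A2)\<close>, then the octahedral axiom for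
  \<open>A1 \<rightarrow> A1 \<oplus> A2 \<rightarrow> M\<close> gives a conflation \<open>A1 \<rightarrow> M \<rightarrow> E2\<close> where \<open>A2 \<rightarrow> E2 \<rightarrow> Z\<close> realises
  \<open>p2 (i1 \<delta>1 + i2 \<delta>2) = \<delta>2\<close>. Hence \<open>E2\<close> is isomorphic to \<open>B2\<close>; the other half is symmetric.
  The comparison isomorphisms stay in the statement; \<open>resolution_iso\<close> below transports resolutions
  along them.
\<close>

lemma common_extension:
  assumes t1: "etriangle C A1 B1 Z x1 y1 \<delta>1" and t2: "etriangle C A2 B2 Z x2 y2 \<delta>2"
  obtains M E1 E2 f1 f2 u1 v1 u2 v2 where
    "conflation C A1 M E2 u1 v1" "isomorphism C E2 B2 f2"
    "conflation C A2 M E1 u2 v2" "isomorphism C E1 B1 f1"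
proof -
  note o1 = etriangleD[OF t1] and o2 = etriangleD[OF t2]
  obtain S i1 i2 p1 p2 where S: "biproduct C A1 A2 S i1 i2 p1 p2"
    using biproduct_exists o1 o2 by blast
  have Z: "Z \<in> obj C" and So: "S \<in> obj C" and i: "i1 \<in> homset C A1 S" "i2 \<in> homset C A2 S"
    using S o1 unfolding biproduct_def by auto
  interpret XS: abelian_group "Ext C Z S"
    using Ext_abelian_group Z So by blast
  define \<nu> where "\<nu> = push C Z i1 \<delta>1 \<oplus>\<^bsub>Ext C Z S\<^esub> push C Z i2 \<delta>2"
  have pc: "push C Z i1 \<delta>1 \<in> carrier (Ext C Z S)" "push C Z i2 \<delta>2 \<in> carrier (Ext C Z S)"
    using push_closed Z So i o1 o2 by blast+
  have \<nu>: "\<nu> \<in> carrier (Ext C Z S)"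
    unfolding \<nu>_def using pc by blast
  obtain M g g' where M: "etriangle C S M Z g g' \<nu>"
    using etriangle_exists[OF Z So \<nu>] by blast
  have half: "\<exists>E u v f. conflation C A M E u v \<and> isomorphism C E B' f"
    if t: "etriangle C A' B' Z x' y' \<delta>'" and d: "\<delta> \<in> carrier (Ext C Z A)"
      and bi: "biproduct C A A' S i i' p p'"
      and nu: "\<nu> = push C Z i \<delta> \<oplus>\<^bsub>Ext C Z S\<^esub> push C Z i' \<delta>'"
    for A A' B' x' y' \<delta> \<delta>' i i' p p'
  proof -
    note o = etriangleD[OF t]
    have m: "A \<in> obj C" "i \<in> homset C A S" "i' \<in> homset C A' S" "p' \<in> homset C S A'"
      "p' \<circ>\<^bsub>C\<^esub> i = \<zero>\<^bsub>Hom C A A'\<^esub>" "p' \<circ>\<^bsub>C\<^esub> i' = ident C A'"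
      using bi unfolding biproduct_def by auto
    have cl: "push C Z i \<delta> \<in> carrier (Ext C Z S)" "push C Z i' \<delta>' \<in> carrier (Ext C Z S)"
      using push_closed[OF Z m(1) So m(2) d] push_closed[OF Z o(1) So m(3) o(6)] by auto
    have "push C Z p' \<nu> = push C Z p' (push C Z i \<delta>) \<oplus>\<^bsub>Ext C Z A'\<^esub> push C Z p' (push C Z i' \<delta>')"
      unfolding nu using push_linear[OF Z So o(1) m(4)] cl unfolding linear_map_def by blast
    also have "\<dots> = push C Z (p' \<circ>\<^bsub>C\<^esub> i) \<delta> \<oplus>\<^bsub>Ext C Z A'\<^esub> push C Z (p' \<circ>\<^bsub>C\<^esub> i') \<delta>'"
      using push_comp[OF Z m(1) So o(1) m(2,4) d] push_comp[OF Z o(1) So o(1) m(3,4) o(6)] by simp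
    also have "\<dots> = \<zero>\<^bsub>Ext C Z A'\<^esub> \<oplus>\<^bsub>Ext C Z A'\<^esub> \<delta>'"
      using push_zero_mor[OF Z m(1) o(1) d] push_ident[OF Z o(1,6)] m(5,6) by simp
    also have "\<dots> = \<delta>'"
      using abelian_monoid.l_zero[OF abelian_group.axioms(1)[OF Ext_abelian_group[OF Z o(1)]] o(6)] .
    finally have pn: "push C Z p' \<nu> = \<delta>'" .
    obtain E h' e k \<delta>'' where "etriangle C A M E (g \<circ>\<^bsub>C\<^esub> i) h' \<delta>''"
      and E: "etriangle C A' E Z e k (push C Z p' \<nu>)"
      using ET4[OF biproduct_etriangle[OF bi] M] by blast
    moreover obtain f where "isomorphism C E B' f"
      using etriangle_middle_unique[OF E[unfolded pn] t] by blast
    ultimately show ?thesis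
      unfolding conflation_def by blast
  qed
  have "\<nu> = push C Z i2 \<delta>2 \<oplus>\<^bsub>Ext C Z S\<^esub> push C Z i1 \<delta>1"
    unfolding \<nu>_def using pc XS.a_comm by blast
  then show thesis
    using half[OF t2 o1(6) S \<nu>_def] half[OF t1 o2(6) biproduct_swap[OF S]] that by blast
qed

end

section \<open>The index with respect to a cluster-tilting subcategory\<close>

lemma quotient_eqI:
  fixes G (structure)
  assumes G: "comm_group G" and cl: "a \<in> carrier G" "b \<in> carrier G" "c \<in> carrier G" "d \<in> carrier G"
    and eq: "a \<otimes> d = c \<otimes> b"
  shows "a \<otimes> inv b = c \<otimes> inv d"
proof -
  interpret comm_group G by (rule G)
  have "c \<otimes> inv d \<otimes> b = c \<otimes> b \<otimes> inv d"
    using cl m_assoc[of c "inv d" b] m_assoc[of c b "inv d"] m_comm[of "inv d" b] by simp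
  also have "\<dots> = a \<otimes> (d \<otimes> inv d)"
    using cl m_assoc[of a d "inv d"] by (simp flip: eq)
  finally show ?thesis
    using cl inv_solve_right'[of "c \<otimes> inv d" a b] by simp
qed

context extriangulated_category
begin

lemma mor_sum_closed:
  assumes "biproduct C Y Y' W j1 j2 q1 q2" "biproduct C B B' D k1 k2 r1 r2"
    and "f \<in> homset C Y B" "f' \<in> homset C Y' B'"
  shows "mor_sum C W q1 q2 D k1 k2 f f' \<in> homset C W D"
proof -
  have o: "Y \<in> obj C" "Y' \<in> obj C" "W \<in> obj C" "B \<in> obj C" "B' \<in> obj C" "D \<in> obj C"
    and m: "q1 \<in> homset C W Y" "q2 \<in> homset C W Y'" "k1 \<in> homset C B D" "k2 \<in> homset C B' D"
    using assms(1,2) unfolding biproduct_def by auto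
  have "k1 \<circ>\<^bsub>C\<^esub> f \<circ>\<^bsub>C\<^esub> q1 \<in> homset C W D" "k2 \<circ>\<^bsub>C\<^esub> f' \<circ>\<^bsub>C\<^esub> q2 \<in> homset C W D"
    using comp_closed[OF o(3,1,6) m(1) comp_closed[OF o(1,4,6) assms(3) m(3)]]
      comp_closed[OF o(3,2,6) m(2) comp_closed[OF o(2,5,6) assms(4) m(4)]] .
  then show ?thesis
    unfolding mor_sum_def
    using abelian_monoid.a_closed[OF abelian_group.axioms(1)[OF Hom_abelian_group[OF o(3,6)]]]
    by blast
qed

text \<open>
  Additivity of the realisation, together with the typing of the morphisms \<open>x \<oplus> x'\<close> and \<open>y \<oplus> y'\<close>,
  which identifies the middle term as the given biproduct.
\<close>

lemma conflation_sum:
  assumes t: "etriangle C A B Z x y \<delta>" and t': "etriangle C A' B' Z' x' y' \<delta>'"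
    and A: "biproduct C A A' AS iA iA' pA pA'" and B: "biproduct C B B' BS iB iB' pB pB'"
    and Z: "biproduct C Z Z' ZS iZ iZ' pZ pZ'"
  shows "conflation C AS BS ZS
    (mor_sum C AS pA pA' BS iB iB' x x') (mor_sum C BS pB pB' ZS iZ iZ' y y')"
proof -
  note o = etriangleD[OF t] and o' = etriangleD[OF t']
  have S: "AS \<in> obj C" "BS \<in> obj C" "ZS \<in> obj C"
    "iA \<in> homset C A AS" "iA' \<in> homset C A' AS" "pZ \<in> homset C ZS Z" "pZ' \<in> homset C ZS Z'"
    using A B Z unfolding biproduct_def by auto
  let ?\<nu> = "push C ZS iA (pull C A pZ \<delta>) \<oplus>\<^bsub>Ext C ZS AS\<^esub> push C ZS iA' (pull C A' pZ' \<delta>')"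
  have "?\<nu> \<in> carrier (Ext C ZS AS)"
    by (intro abelian_monoid.a_closed abelian_group.axioms(1)[OF Ext_abelian_group]
      push_closed[of _ A] push_closed[of _ A'] pull_closed[of Z] pull_closed[of Z'] o o' S)
  moreover have "composable C AS BS ZS
      (mor_sum C AS pA pA' BS iB iB' x x') (mor_sum C BS pB pB' ZS iZ iZ' y y')"
    using mor_sum_closed[OF A B o(4) o'(4)] mor_sum_closed[OF B Z o(5) o'(5)] S(1-3)
    unfolding composable_def by blast
  ultimately show ?thesis
    using real_sum[OF t t' A B Z] unfolding conflation_def etriangle_def by blast
qed

context
  fixes T assumes T: "cluster_tilting C T"
begin

lemma cluster_tilting_obj: "X \<in> T \<Longrightarrow> X \<in> obj C"
  using T unfolding cluster_tilting_def by blast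

lemma cluster_tilting_rigid:
  assumes "V \<in> T" "X \<in> T" "\<epsilon> \<in> carrier (Ext C V X)"
  shows "\<epsilon> = \<zero>\<^bsub>Ext C V X\<^esub>"
proof -
  have "T = {X \<in> obj C. \<forall>V \<in> T. carrier (Ext C V X) = {\<zero>\<^bsub>Ext C V X\<^esub>}}"
    using T unfolding cluster_tilting_def by (elim conjE)
  then have "carrier (Ext C V X) = {\<zero>\<^bsub>Ext C V X\<^esub>}"
    using assms by blast
  then show ?thesis
    using assms(3) by simp
qed

lemma cluster_tilting_memI:
  assumes "X \<in> obj C" "\<And>V \<epsilon>. \<lbrakk>V \<in> T; \<epsilon> \<in> carrier (Ext C V X)\<rbrakk> \<Longrightarrow> \<epsilon> = \<zero>\<^bsub>Ext C V X\<^esub>"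
  shows "X \<in> T"
proof -
  have "T = {X \<in> obj C. \<forall>V \<in> T. carrier (Ext C V X) = {\<zero>\<^bsub>Ext C V X\<^esub>}}"
    using T unfolding cluster_tilting_def by (elim conjE)
  moreover have "carrier (Ext C V X) = {\<zero>\<^bsub>Ext C V X\<^esub>}" if "V \<in> T" for V
    using assms that zero_ext_closed[OF cluster_tilting_obj[OF that] assms(1)] by blast
  ultimately show ?thesis
    using assms(1) by blast
qed

lemma cluster_tilting_zero:
  assumes "zero_object C Z"
  shows "Z \<in> T"
proof (rule cluster_tilting_memI)
  show Z: "Z \<in> obj C"
    using assms unfolding zero_object_def by blast
  fix V \<epsilon> assume V: "V \<in> T" and e: "\<epsilon> \<in> carrier (Ext C V Z)"
  have "\<epsilon> = push C V \<zero>\<^bsub>Hom C Z Z\<^esub> \<epsilon>"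
    using push_ident[OF cluster_tilting_obj[OF V] Z e] assms unfolding zero_object_def by simp
  also have "\<dots> = \<zero>\<^bsub>Ext C V Z\<^esub>"
    by (rule push_zero_mor[OF cluster_tilting_obj[OF V] Z Z e])
  finally show "\<epsilon> = \<zero>\<^bsub>Ext C V Z\<^esub>" .
qed

text \<open>
  Ext commutes with the biproduct: decomposing \<open>id = i1 p1 + i2 p2\<close> writes every extension by \<open>S\<close> as a
  sum of two that factor through extensions by \<open>X\<close> and by \<open>Y\<close>.
\<close>

lemma cluster_tilting_biproduct:
  assumes S: "biproduct C X Y S i1 i2 p1 p2" and X: "X \<in> T" and Y: "Y \<in> T"
  shows "S \<in> T"
proof (rule cluster_tilting_memI)
  have o: "X \<in> obj C" "Y \<in> obj C" "S \<in> obj C"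
    and m: "i1 \<in> homset C X S" "i2 \<in> homset C Y S" "p1 \<in> homset C S X" "p2 \<in> homset C S Y"
    and id: "(i1 \<circ>\<^bsub>C\<^esub> p1) \<oplus>\<^bsub>Hom C S S\<^esub> (i2 \<circ>\<^bsub>C\<^esub> p2) = ident C S"
    using S unfolding biproduct_def by auto
  show "S \<in> obj C" by (rule o)
  fix V \<epsilon> assume V: "V \<in> T" and e: "\<epsilon> \<in> carrier (Ext C V S)"
  note Vo = cluster_tilting_obj[OF V]
  have summand: "push C V (i \<circ>\<^bsub>C\<^esub> p) \<epsilon> = \<zero>\<^bsub>Ext C V S\<^esub>"
    if W: "W \<in> T" and i: "i \<in> homset C W S" and p: "p \<in> homset C S W" for W i p
  proof -
    note Wo = cluster_tilting_obj[OF W]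
    have "push C V p \<epsilon> = \<zero>\<^bsub>Ext C V W\<^esub>"
      by (rule cluster_tilting_rigid[OF V W push_closed[OF Vo o(3) Wo p e]])
    then show ?thesis
      using push_comp[OF Vo o(3) Wo o(3) p i e] push_zero_ext[OF Vo Wo o(3) i] by simp
  qed
  have "\<epsilon> = push C V ((i1 \<circ>\<^bsub>C\<^esub> p1) \<oplus>\<^bsub>Hom C S S\<^esub> (i2 \<circ>\<^bsub>C\<^esub> p2)) \<epsilon>"
    unfolding id by (rule push_ident[OF Vo o(3) e, symmetric])
  also have "\<dots> = push C V (i1 \<circ>\<^bsub>C\<^esub> p1) \<epsilon> \<oplus>\<^bsub>Ext C V S\<^esub> push C V (i2 \<circ>\<^bsub>C\<^esub> p2) \<epsilon>"
    using push_linear_mor[OF Vo o(3,3) e] comp_closed[OF o(3,1,3) m(3,1)]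
      comp_closed[OF o(3,2,3) m(4,2)] unfolding linear_map_def by blast
  also have "\<dots> = \<zero>\<^bsub>Ext C V S\<^esub>"
    using summand[OF X m(1,3)] summand[OF Y m(2,4)] zero_ext_closed[OF Vo o(3)]
      abelian_monoid.l_zero[OF abelian_group.axioms(1)[OF Ext_abelian_group[OF Vo o(3)]]] by simp
  finally show "\<epsilon> = \<zero>\<^bsub>Ext C V S\<^esub>" .
qed

lemmas class_closed = K0_class_closed[of _ T C]

lemma K0_class_zero:
  assumes Z: "zero_object C Z"
  shows "K0_class C T Z = \<one>\<^bsub>K0 C T\<^esub>"
proof -
  interpret G: comm_group "K0 C T" by (rule K0_comm_group)
  note ZT = cluster_tilting_zero[OF Z]
  obtain p where b: "biproduct C Z Z Z (ident C Z) \<zero>\<^bsub>Hom C Z Z\<^esub> p \<zero>\<^bsub>Hom C Z Z\<^esub>"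
    by (rule biproduct_zero_right[OF Z ident_isomorphism[OF cluster_tilting_obj[OF ZT]]])
  have "K0_class C T Z = K0_class C T Z \<otimes>\<^bsub>K0 C T\<^esub> K0_class C T Z"
    by (rule K0_class_biproduct[OF b ZT ZT ZT])
  then show ?thesis
    using class_closed[OF ZT] G.r_cancel_one' by metis
qed

lemma cluster_tilting_iso:
  assumes f: "isomorphism C X Y f" and X: "X \<in> T"
  shows "Y \<in> T" and "K0_class C T Y = K0_class C T X"
proof -
  interpret G: comm_group "K0 C T" by (rule K0_comm_group)
  obtain Z where Z: "zero_object C Z"
    using zero_object_exists by blast
  obtain g where b: "biproduct C X Z Y f \<zero>\<^bsub>Hom C Z Y\<^esub> g \<zero>\<^bsub>Hom C Y Z\<^esub>"
    by (rule biproduct_zero_right[OF Z f])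
  show Y: "Y \<in> T"
    by (rule cluster_tilting_biproduct[OF b X cluster_tilting_zero[OF Z]])
  show "K0_class C T Y = K0_class C T X"
    using K0_class_biproduct[OF b Y X cluster_tilting_zero[OF Z]] K0_class_zero[OF Z]
      class_closed[OF X] by simp
qed

text \<open>
  Conflations with both ends in \<open>T\<close> split, by rigidity.
\<close>

lemma cluster_tilting_extension:
  assumes c: "conflation C A B Z x y" and A: "A \<in> T" and Z: "Z \<in> T"
  shows "B \<in> T" and "K0_class C T B = K0_class C T A \<otimes>\<^bsub>K0 C T\<^esub> K0_class C T Z"
proof -
  obtain \<delta> where t: "etriangle C A B Z x y \<delta>"
    using c unfolding conflation_def by blast
  have "\<delta> = \<zero>\<^bsub>Ext C Z A\<^esub>"
    by (rule cluster_tilting_rigid[OF Z A etriangleD(6)[OF t]])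
  then obtain i1 i2 p1 p2 where b: "biproduct C A Z B i1 i2 p1 p2"
    using split_etriangle t by blast
  show B: "B \<in> T"
    by (rule cluster_tilting_biproduct[OF b A Z])
  show "K0_class C T B = K0_class C T A \<otimes>\<^bsub>K0 C T\<^esub> K0_class C T Z"
    by (rule K0_class_biproduct[OF b B A Z])
qed

text \<open>
  The kernel \<open>A\<close> of a right approximation \<open>r : R \<rightarrow> X\<close> lies in \<open>T\<close>: an extension of \<open>V \<in> T\<close> by \<open>A\<close> dies
  in \<open>Ext(V, R) = 0\<close>, hence comes from some \<open>V \<rightarrow> X\<close>. That morphism factors through \<open>r\<close>, and pulling
  back along \<open>r\<close> kills the extension of \<open>X\<close> by \<open>A\<close>.
\<close>

lemma resolution_exists:
  assumes X: "X \<in> obj C"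
  obtains A R x y where "A \<in> T" "R \<in> T" "conflation C A R X x y"
proof -
  obtain R r where r: "right_approximation C T R X r" and d: "deflation C R X r"
    using T X unfolding cluster_tilting_def by blast
  obtain A x \<delta> where t: "etriangle C A R X x r \<delta>"
    using d unfolding deflation_def conflation_def by blast
  note o = etriangleD[OF t]
  have R: "R \<in> T"
    using r unfolding right_approximation_def by blast
  have "A \<in> T"
  proof (rule cluster_tilting_memI[OF o(1)])
    fix V \<epsilon> assume V: "V \<in> T" and e: "\<epsilon> \<in> carrier (Ext C V A)"
    note Vo = cluster_tilting_obj[OF V]
    have "push C V x \<epsilon> = \<zero>\<^bsub>Ext C V R\<^esub>"
      by (rule cluster_tilting_rigid[OF V R push_closed[OF Vo o(1,2,4) e]])
    then obtain c where c: "c \<in> homset C V X" "\<epsilon> = pull C A c \<delta>"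
      using ext_killed_by_inflation[OF t Vo e] by blast
    obtain g where g: "g \<in> homset C V R" "c = r \<circ>\<^bsub>C\<^esub> g"
      using r V c(1) unfolding right_approximation_def by blast
    have "\<epsilon> = pull C A g (pull C A r \<delta>)"
      using pull_comp[OF X o(2) Vo o(1) o(5) g(1) o(6)] c(2) g(2) by simp
    then show "\<epsilon> = \<zero>\<^bsub>Ext C V A\<^esub>"
      using pull_deflation_zero[OF t] pull_zero_ext[OF o(2) Vo o(1) g(1)] by simp
  qed
  then show thesis
    using that R t unfolding conflation_def by blast
qed

text \<open>
  The deflation \<open>R \<rightarrow> E\<close> is composed with the deflation \<open>E \<rightarrow> X\<close> with zero kernel. The octahedral
  axiom makes the kernel \<open>A'\<close> of the composite an extension of a zero object by \<open>A\<close>, so \<open>A'\<close> may differ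
  from \<open>A\<close> but has the same class.
\<close>

lemma resolution_iso:
  assumes c: "conflation C A R E x y" and A: "A \<in> T" and f: "isomorphism C E X f"
  obtains A' x' y' where "A' \<in> T" "conflation C A' R X x' y'" "K0_class C T A' = K0_class C T A"
proof -
  interpret G: comm_group "K0 C T" by (rule K0_comm_group)
  obtain \<delta> where t: "etriangle C A R E x y \<delta>"
    using c unfolding conflation_def by blast
  note o = etriangleD[OF t]
  obtain N where N: "zero_object C N"
    using zero_object_exists by blast
  then have N': "N \<in> obj C"
    unfolding zero_object_def by blast
  obtain A' h' d e \<delta>'' where A': "etriangle C A' R X h' (f \<circ>\<^bsub>C\<^esub> y) \<delta>''"
    and k: "etriangle C A A' N d e (pull C A \<zero>\<^bsub>Hom C N E\<^esub> \<delta>)"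
    using ET4_op[OF t iso_etriangle_left[OF N f]] by blast
  have k': "conflation C A A' N d e"
    using k unfolding conflation_def by blast
  have "A' \<in> T" "K0_class C T A' = K0_class C T A"
    using cluster_tilting_extension[OF k' A cluster_tilting_zero[OF N]] K0_class_zero[OF N]
      class_closed[OF A] by auto
  then show thesis
    using that A' unfolding conflation_def by blast
qed

text \<open>
  The common extension \<open>M\<close> of two resolutions lies in conflations \<open>A1 \<rightarrow> M \<rightarrow> R2\<close> and \<open>A2 \<rightarrow> M \<rightarrow> R1\<close>
  (up to isomorphism of the right ends). Both split, so
  \<open>[A1] + [R2] = [M] = [A2] + [R1]\<close>.
\<close>

lemma resolution_class_unique:
  assumes c1: "conflation C A1 R1 X x1 y1" and c2: "conflation C A2 R2 X x2 y2"
    and T1: "A1 \<in> T" "R1 \<in> T" and T2: "A2 \<in> T" "R2 \<in> T"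
  shows "K0_class C T R1 \<otimes>\<^bsub>K0 C T\<^esub> inv\<^bsub>K0 C T\<^esub> K0_class C T A1 =
    K0_class C T R2 \<otimes>\<^bsub>K0 C T\<^esub> inv\<^bsub>K0 C T\<^esub> K0_class C T A2"
proof -
  interpret G: comm_group "K0 C T" by (rule K0_comm_group)
  let ?c = "K0_class C T"
  obtain M E1 E2 f1 f2 u1 v1 u2 v2 where
    M: "conflation C A1 M E2 u1 v1" "isomorphism C E2 R2 f2"
      "conflation C A2 M E1 u2 v2" "isomorphism C E1 R1 f1"
    using c1 c2 common_extension unfolding conflation_def[of C A1 R1] conflation_def[of C A2 R2]
    by metis
  obtain g1 g2 where g: "isomorphism C R1 E1 g1" "isomorphism C R2 E2 g2"
    using M(2,4) isomorphism_sym by metis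
  have "?c M = ?c A1 \<otimes>\<^bsub>K0 C T\<^esub> ?c R2" "?c M = ?c A2 \<otimes>\<^bsub>K0 C T\<^esub> ?c R1"
    using cluster_tilting_extension(2)[OF M(1) T1(1)] cluster_tilting_extension(2)[OF M(3) T2(1)]
      cluster_tilting_iso[OF g(1) T1(2)] cluster_tilting_iso[OF g(2) T2(2)] by simp_all
  then have eq: "?c A1 \<otimes>\<^bsub>K0 C T\<^esub> ?c R2 = ?c A2 \<otimes>\<^bsub>K0 C T\<^esub> ?c R1"
    by simp
  have cl: "?c A1 \<in> carrier (K0 C T)" "?c A2 \<in> carrier (K0 C T)"
    "?c R1 \<in> carrier (K0 C T)" "?c R2 \<in> carrier (K0 C T)"
    by (intro class_closed T1 T2)+
  show ?thesis
    by (rule quotient_eqI[OF K0_comm_group cl(3,1,4,2)])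
      (simp only: G.m_comm[OF cl(3,2)] G.m_comm[OF cl(4,1)] eq)
qed

lemma index_eqI:
  assumes c: "conflation C A R X x y" and A: "A \<in> T" and R: "R \<in> T"
  shows "index C T X = K0_class C T R \<otimes>\<^bsub>K0 C T\<^esub> inv\<^bsub>K0 C T\<^esub> K0_class C T A"
  unfolding index_def
proof (rule the_equality)
  fix g assume "\<exists>A \<in> T. \<exists>R \<in> T. \<exists>x y. conflation C A R X x y \<and>
    g = K0_class C T R \<otimes>\<^bsub>K0 C T\<^esub> inv\<^bsub>K0 C T\<^esub> K0_class C T A"
  then show "g = K0_class C T R \<otimes>\<^bsub>K0 C T\<^esub> inv\<^bsub>K0 C T\<^esub> K0_class C T A"
    using resolution_class_unique c A R by blast
qed (use assms in blast)

lemma index_closed: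
  assumes "X \<in> obj C"
  shows "index C T X \<in> carrier (K0 C T)"
proof -
  interpret G: comm_group "K0 C T" by (rule K0_comm_group)
  obtain A R x y where r: "A \<in> T" "R \<in> T" "conflation C A R X x y"
    using resolution_exists[OF assms] by blast
  then show ?thesis
    using index_eqI[OF r(3,1,2)] class_closed by simp
qed

text \<open>
  If \<open>K \<rightarrow> R \<rightarrow> Z\<close> is a resolution by objects of \<open>T\<close>, the
  common extension \<open>M\<close> of \<open>B\<close> and \<open>R\<close> over \<open>Z\<close> is an extension of \<open>R\<close> by \<open>A\<close>, hence lies in \<open>T\<close> with
  \<open>[M] = [A] + [R]\<close>. It is also the middle term of a resolution of \<open>B\<close> whose kernel has the class of
  \<open>K\<close>, so the index of \<open>B\<close> is \<open>[M] - [K]\<close>.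
\<close>

lemma index_conflation:
  assumes c: "conflation C A B Z x y" and A: "A \<in> T"
  shows "index C T B = K0_class C T A \<otimes>\<^bsub>K0 C T\<^esub> index C T Z"
proof -
  interpret G: comm_group "K0 C T" by (rule K0_comm_group)
  let ?c = "K0_class C T"
  have Z: "Z \<in> obj C"
    using c unfolding conflation_def etriangle_def composable_def by blast
  obtain K R k r where r: "K \<in> T" "R \<in> T" "conflation C K R Z k r"
    using resolution_exists[OF Z] by blast
  obtain M E1 E2 f1 f2 u1 v1 u2 v2 where
    M: "conflation C A M E2 u1 v1" "isomorphism C E2 R f2"
      "conflation C K M E1 u2 v2" "isomorphism C E1 B f1"
    using c r(3) common_extension unfolding conflation_def[of C A B] conflation_def[of C K R]
    by metis
  obtain g where g: "isomorphism C R E2 g"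
    using M(2) isomorphism_sym by metis
  have M': "M \<in> T" "?c M = ?c A \<otimes>\<^bsub>K0 C T\<^esub> ?c R"
    using cluster_tilting_extension[OF M(1) A] cluster_tilting_iso[OF g r(2)] by simp_all
  obtain K' k' r' where K': "K' \<in> T" "conflation C K' M B k' r'" "?c K' = ?c K"
    using resolution_iso[OF M(3) r(1) M(4)] by blast
  have "index C T B = (?c A \<otimes>\<^bsub>K0 C T\<^esub> ?c R) \<otimes>\<^bsub>K0 C T\<^esub> inv\<^bsub>K0 C T\<^esub> ?c K"
    using index_eqI[OF K'(2,1) M'(1)] M'(2) K'(3) by simp
  also have "\<dots> = ?c A \<otimes>\<^bsub>K0 C T\<^esub> index C T Z"
    using index_eqI[OF r(3,1,2)] class_closed A r(1,2) by (simp add: G.m_assoc)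
  finally show ?thesis .
qed

lemma index_biproduct:
  assumes S: "biproduct C X Y S i1 i2 p1 p2"
  shows "index C T S = index C T X \<otimes>\<^bsub>K0 C T\<^esub> index C T Y"
proof -
  interpret G: comm_group "K0 C T" by (rule K0_comm_group)
  let ?c = "K0_class C T"
  have o: "X \<in> obj C" "Y \<in> obj C" "S \<in> obj C"
    using S unfolding biproduct_def by auto
  obtain A R x y where r: "A \<in> T" "R \<in> T" "conflation C A R X x y"
    using resolution_exists[OF o(1)] by blast
  obtain A' R' x' y' where r': "A' \<in> T" "R' \<in> T" "conflation C A' R' Y x' y'"
    using resolution_exists[OF o(2)] by blast
  note ob = r(1,2)[THEN cluster_tilting_obj] r'(1,2)[THEN cluster_tilting_obj]
  obtain SA a1 a2 b1 b2 where SA: "biproduct C A A' SA a1 a2 b1 b2"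
    using biproduct_exists[OF ob(1,3)] by blast
  obtain SR c1 c2 d1 d2 where SR: "biproduct C R R' SR c1 c2 d1 d2"
    using biproduct_exists[OF ob(2,4)] by blast
  have ST: "SA \<in> T" "SR \<in> T"
    using cluster_tilting_biproduct[OF SA r(1) r'(1)] cluster_tilting_biproduct[OF SR r(2) r'(2)] .
  obtain \<delta> \<delta>' where t: "etriangle C A R X x y \<delta>" "etriangle C A' R' Y x' y' \<delta>'"
    using r(3) r'(3) unfolding conflation_def by blast
  have "conflation C SA SR S (mor_sum C SA b1 b2 SR c1 c2 x x') (mor_sum C SR d1 d2 S i1 i2 y y')"
    by (rule conflation_sum[OF t SA SR S])
  from index_eqI[OF this ST] have "index C T S =
      (?c R \<otimes>\<^bsub>K0 C T\<^esub> ?c R') \<otimes>\<^bsub>K0 C T\<^esub> inv\<^bsub>K0 C T\<^esub> (?c A \<otimes>\<^bsub>K0 C T\<^esub> ?c A')"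
    using K0_class_biproduct[OF SA ST(1) r(1) r'(1)] K0_class_biproduct[OF SR ST(2) r(2) r'(2)] by simp
  also have "\<dots> = index C T X \<otimes>\<^bsub>K0 C T\<^esub> index C T Y"
    unfolding index_eqI[OF r(3,1,2)] index_eqI[OF r'(3,1,2)]
    using r(1,2) r'(1,2) class_closed
    by (simp add: G.inv_mult G.m_ac)
  finally show ?thesis .
qed

end

end

section \<open>The opposite extriangulated category\<close>

text \<open>
  The coindex in \<open>C\<close> is the index in the opposite category, so each fact about the index gives
  its counterpart for the coindex.
\<close>

definition opposite :: "('o, 'm, 'k, 'e, 'x) extcat_scheme \<Rightarrow> ('o, 'm, 'k, 'e) extcat" where
  "opposite C = \<lparr>obj = obj C, Hom = (\<lambda>X Y. Hom C Y X), ident = ident C,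
     mcomp = (\<lambda>g f. f \<circ>\<^bsub>C\<^esub> g), Ext = (\<lambda>X Y. Ext C Y X), push = pull C, pull = push C,
     realise = (\<lambda>X Y \<delta>. {(x, y). (y, x) \<in> realise C Y X \<delta>})\<rparr>"

lemma opposite_simps [simp]:
  "obj (opposite C) = obj C" "Hom (opposite C) X Y = Hom C Y X" "ident (opposite C) = ident C"
  "g \<circ>\<^bsub>opposite C\<^esub> f = f \<circ>\<^bsub>C\<^esub> g" "Ext (opposite C) X Y = Ext C Y X"
  "push (opposite C) = pull C" "pull (opposite C) = push C"
  by (simp_all add: opposite_def)

lemma zero_object_opposite [simp]: "zero_object (opposite C) Z = zero_object C Z"
  by (simp add: zero_object_def)

lemma biproduct_opposite [simp]:
  "biproduct (opposite C) X Y S i1 i2 p1 p2 = biproduct C X Y S p1 p2 i1 i2"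
  unfolding biproduct_def by auto

lemma composable_opposite [simp]: "composable (opposite C) A B Z x y = composable C Z B A y x"
  unfolding composable_def by auto

lemma etriangle_opposite [simp]: "etriangle (opposite C) A B Z x y \<delta> = etriangle C Z B A y x \<delta>"
  by (simp add: etriangle_def) (simp add: opposite_def)

lemma conflation_opposite [simp]: "conflation (opposite C) A B Z x y = conflation C Z B A y x"
  by (simp add: conflation_def)

lemma inflation_opposite: "inflation (opposite C) A B x = deflation C B A x"
  by (simp add: inflation_def deflation_def)

lemma deflation_opposite: "deflation (opposite C) B Z y = inflation C Z B y"
  by (simp add: inflation_def deflation_def)

lemma cluster_tilting_opposite: "cluster_tilting (opposite C) T = cluster_tilting C T"
  unfolding cluster_tilting_def left_approximation_def right_approximation_def
    inflation_opposite deflation_opposite opposite_simps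
  by (safe; blast)

lemma K0_kernel_opposite: "K0_kernel (opposite C) T = K0_kernel C T"
proof -
  have "K0_relations (opposite C) T = K0_relations C T"
    unfolding K0_relations_def biproduct_opposite by blast
  then show ?thesis
    by (simp add: K0_kernel_def)
qed

lemma K0_opposite: "K0 (opposite C) = K0 C"
  by (simp add: K0_def K0_kernel_opposite fun_eq_iff)

lemma K0_class_opposite: "K0_class (opposite C) = K0_class C"
  by (simp add: K0_class_def K0_kernel_opposite fun_eq_iff)

lemma index_opposite: "index (opposite C) T X = coindex C T X"
  unfolding index_def coindex_def K0_opposite K0_class_opposite conflation_opposite
  by (rule arg_cong[where f = The]) blast

lemma coindex_opposite: "coindex (opposite C) T X = index C T X"
  unfolding index_def coindex_def K0_opposite K0_class_opposite conflation_opposite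
  by (rule arg_cong[where f = The]) blast

lemma index_hom_opposite: "index_hom (opposite C) T U = coindex_hom C T U"
  by (simp add: index_hom_def coindex_hom_def index_opposite K0_opposite K0_class_opposite)

lemma coindex_hom_opposite: "coindex_hom (opposite C) T U = index_hom C T U"
  by (simp add: index_hom_def coindex_hom_def coindex_opposite K0_opposite K0_class_opposite)

context linear_category
begin

text \<open>
  Reversing arrows inverts the direction of the comparison isomorphism between two sequences, so
  equivalence of sequences has to be recognised from an isomorphism in the other direction.
\<close>

lemma seq_equiv_flip:
  assumes "\<exists>B B' b. composable C A B Z x y \<and> composable C A B' Z x' y' \<and>
    isomorphism C B' B b \<and> b \<circ>\<^bsub>C\<^esub> x' = x \<and> y \<circ>\<^bsub>C\<^esub> b = y'"
  shows "seq_equiv C A Z (x, y) (x', y')"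
proof -
  obtain B B' b where s: "composable C A B Z x y" "composable C A B' Z x' y'"
    "isomorphism C B' B b" "b \<circ>\<^bsub>C\<^esub> x' = x" "y \<circ>\<^bsub>C\<^esub> b = y'"
    using assms by blast
  have o: "A \<in> obj C" "B \<in> obj C" "B' \<in> obj C" "Z \<in> obj C" "x' \<in> homset C A B'" "y \<in> homset C B Z"
    "b \<in> homset C B' B"
    using s unfolding composable_def isomorphism_def by auto
  obtain g where g: "isomorphism C B B' g" "g \<circ>\<^bsub>C\<^esub> b = ident C B'" "b \<circ>\<^bsub>C\<^esub> g = ident C B"
    using isomorphism_sym[OF s(3)] by blast
  have gm: "g \<in> homset C B B'"
    using g(1) unfolding isomorphism_def by blast
  have "g \<circ>\<^bsub>C\<^esub> x = x'"
    using comp_assoc[OF o(1,3,2,3,5,7) gm] ident_comp[OF o(1,3,5)] g(2) s(4) by simp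
  moreover have "y' \<circ>\<^bsub>C\<^esub> g = y"
    using comp_assoc[OF o(2,3,2,4) gm o(7,6)] comp_ident[OF o(2,4,6)] g(3) s(5) by simp
  ultimately show ?thesis
    unfolding seq_equiv_def using s(1,2) g(1) by auto
qed

end

lemma isomorphism_opposite [simp]: "isomorphism (opposite C) X Y f = isomorphism C Y X f"
  unfolding isomorphism_def by auto

text \<open>
  The two sides bracket the composites differently, so typing is needed to apply associativity.
\<close>

lemma mor_sum_opposite:
  assumes "linear_category K C"
    and "biproduct C Y Y' W j1 j2 q1 q2" "biproduct C B B' D k1 k2 r1 r2"
    and "f \<in> homset C B Y" "f' \<in> homset C B' Y'"
  shows "mor_sum (opposite C) W j1 j2 D r1 r2 f f' = mor_sum C D r1 r2 W j1 j2 f f'"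
proof -
  interpret linear_category K C by fact
  have o: "Y \<in> obj C" "Y' \<in> obj C" "W \<in> obj C" "B \<in> obj C" "B' \<in> obj C" "D \<in> obj C"
    and m: "j1 \<in> homset C Y W" "j2 \<in> homset C Y' W" "r1 \<in> homset C D B" "r2 \<in> homset C D B'"
    using assms(2,3) unfolding biproduct_def by auto
  show ?thesis
    unfolding mor_sum_def opposite_simps
    using comp_assoc[OF o(6,4,1,3) m(3) assms(4) m(1)] comp_assoc[OF o(6,5,2,3) m(4) assms(5) m(2)]
    by simp
qed

lemma opposite_additive_category:
  assumes "additive_category K C"
  shows "additive_category K (opposite C)"
proof -
  interpret additive_category K C by fact
  show ?thesis
  proof (intro additive_category.intro linear_category.intro additive_category_axioms.intro,
      unfold opposite_simps zero_object_opposite biproduct_opposite)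
    show "\<exists>S i1 i2 p1 p2. biproduct C X Y S p1 p2 i1 i2" if "X \<in> obj C" "Y \<in> obj C" for X Y
      using biproduct_exists[OF that] by blast
    show "X = X' \<and> Y = Y'"
      if "X \<in> obj C" "Y \<in> obj C" "X' \<in> obj C" "Y' \<in> obj C" "f \<in> homset C Y X" "f \<in> homset C Y' X'"
      for X Y X' Y' f
      using Hom_disjoint[OF that(2,1,4,3,5,6)] by simp
    show "f \<circ>\<^bsub>C\<^esub> (g \<circ>\<^bsub>C\<^esub> h) = (f \<circ>\<^bsub>C\<^esub> g) \<circ>\<^bsub>C\<^esub> h"
      if "W \<in> obj C" "X \<in> obj C" "Y \<in> obj C" "Z \<in> obj C"
        "f \<in> homset C X W" "g \<in> homset C Y X" "h \<in> homset C Z Y" for W X Y Z f g h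
      using comp_assoc[OF that(4,3,2,1,7,6,5)] by simp
  qed (fact field_K zero_object_exists | (rule Hom_module ident_closed comp_closed comp_ident
      ident_comp comp_linear_left comp_linear_right; assumption))+
qed

text \<open>
  The axioms come in dual pairs: the actions on Ext, (ET3) and (ET4) are exchanged with their duals,
  while the axioms on realisations are self-dual up to exchanging the summands of biproducts and
  commuting push-forwards with pullbacks.
\<close>

lemma opposite_extriangulated_category:
  assumes "extriangulated_category K C"
  shows "extriangulated_category K (opposite C)"
proof -
  interpret extriangulated_category K C by fact
  interpret op: additive_category K "opposite C"
    by (rule opposite_additive_category) (rule additive_category_axioms)
  show ?thesis
  proof (intro extriangulated_category.intro extriangulated_category_axioms.intro
      op.additive_category_axioms, unfold opposite_simps etriangle_opposite biproduct_opposite composable_opposite)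
    show "\<exists>B x y. composable C X B Y y x \<and>
        realise (opposite C) X Y \<delta> = {s. seq_equiv (opposite C) Y X (x, y) s}"
      if \<delta>: "X \<in> obj C" "Y \<in> obj C" "\<delta> \<in> carrier (Ext C Y X)" for X Y \<delta>
    proof -
      obtain B x y where B: "composable C X B Y x y" "realise C Y X \<delta> = {s. seq_equiv C X Y (x, y) s}"
        using real_class[OF \<delta>(2,1,3)] by blast
      have "seq_equiv (opposite C) Y X (y, x) (y', x') \<longleftrightarrow> seq_equiv C X Y (x, y) (x', y')" for x' y'
      proof
        assume "seq_equiv (opposite C) Y X (y, x) (y', x')"
        then show "seq_equiv C X Y (x, y) (x', y')"
          by (intro seq_equiv_flip) (auto simp: seq_equiv_def)
      next
        assume "seq_equiv C X Y (x, y) (x', y')"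
        then show "seq_equiv (opposite C) Y X (y, x) (y', x')"
          by (intro op.seq_equiv_flip) (auto simp: seq_equiv_def)
      qed
      then have "realise (opposite C) X Y \<delta> = {s. seq_equiv (opposite C) Y X (y, x) s}"
        using B(2) by (auto simp: opposite_def)
      then show ?thesis
        using B(1) by blast
    qed
  next
    fix A B Z x y \<delta> A' B' Z' x' y' \<delta>' AS iA iA' pA pA' BS iB iB' pB pB' ZS iZ iZ' pZ pZ'
    assume t: "etriangle C Z B A y x \<delta>" "etriangle C Z' B' A' y' x' \<delta>'"
      and b: "biproduct C A A' AS pA pA' iA iA'" "biproduct C B B' BS pB pB' iB iB'"
        "biproduct C Z Z' ZS pZ pZ' iZ iZ'"
    note s = real_sum[OF t b(3,2,1)]
    show "(mor_sum (opposite C) AS pA pA' BS iB iB' x x',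
       mor_sum (opposite C) BS pB pB' ZS iZ iZ' y y')
      \<in> realise (opposite C) ZS AS
          (pull C ZS iA (push C A pZ \<delta>) \<oplus>\<^bsub>Ext C AS ZS\<^esub>
           pull C ZS iA' (push C A' pZ' \<delta>'))"
    proof -
      note o = etriangleD[OF t(1)] and o' = etriangleD[OF t(2)]
      have S: "AS \<in> obj C" "ZS \<in> obj C" "iA \<in> homset C AS A" "iA' \<in> homset C AS A'"
        "pZ \<in> homset C Z ZS" "pZ' \<in> homset C Z' ZS"
        using b unfolding biproduct_def by auto
      show ?thesis
        using s pull_push[OF o(3) S(1) o(1) S(2,5,3) o(6)] pull_push[OF o'(3) S(1) o'(1) S(2,6,4) o'(6)]
          mor_sum_opposite[OF linear_category_axioms b(1,2) o(5) o'(5)]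
          mor_sum_opposite[OF linear_category_axioms b(2,3) o(4) o'(4)]
        by (simp add: opposite_def)
    qed
  next
    fix A B Z x y \<delta> A' B' Z' x' y' \<delta>' a c
    assume "etriangle C Z B A y x \<delta>" "etriangle C Z' B' A' y' x' \<delta>'" "a \<in> homset C A' A"
      "c \<in> homset C Z' Z" "pull C Z a \<delta> = push C A' c \<delta>'"
    from real_morphism[OF this(2,1,4,3) this(5)[symmetric]]
    show "\<exists>b\<in>homset C B' B. x \<circ>\<^bsub>C\<^esub> b = a \<circ>\<^bsub>C\<^esub> x' \<and> b \<circ>\<^bsub>C\<^esub> y' = y \<circ>\<^bsub>C\<^esub> c"
      by blast
  next
    fix A B Z x y \<delta> A' B' Z' x' y' \<delta>' a b
    assume "etriangle C Z B A y x \<delta>" "etriangle C Z' B' A' y' x' \<delta>'" "a \<in> homset C A' A"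
      "b \<in> homset C B' B" "x \<circ>\<^bsub>C\<^esub> b = a \<circ>\<^bsub>C\<^esub> x'"
    from ET3_op[OF this(2,1,4,3) this(5)[symmetric]]
    show "\<exists>c\<in>homset C Z' Z. y \<circ>\<^bsub>C\<^esub> c = b \<circ>\<^bsub>C\<^esub> y' \<and> pull C Z a \<delta> = push C A' c \<delta>'"
      by metis
  next
    fix A B Z x y \<delta> A' B' Z' x' y' \<delta>' b c
    assume "etriangle C Z B A y x \<delta>" "etriangle C Z' B' A' y' x' \<delta>'" "b \<in> homset C B' B"
      "c \<in> homset C Z' Z" "y \<circ>\<^bsub>C\<^esub> c = b \<circ>\<^bsub>C\<^esub> y'"
    from ET3[OF this(2,1,4,3) this(5)[symmetric]]
    show "\<exists>a\<in>homset C A' A. x \<circ>\<^bsub>C\<^esub> b = a \<circ>\<^bsub>C\<^esub> x' \<and> pull C Z a \<delta> = push C A' c \<delta>'"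
      by metis
  next
    fix A B D f f' \<delta> Z F g g' \<delta>'
    assume "etriangle C D B A f' f \<delta>" "etriangle C F Z B g' g \<delta>'"
    from ET4_op[OF this(2,1)]
    show "\<exists>E h' d e \<delta>''. etriangle C E Z A h' (f \<circ>\<^bsub>C\<^esub> g) \<delta>'' \<and>
          etriangle C F E D e d (pull C F f' \<delta>') \<and> g \<circ>\<^bsub>C\<^esub> h' = f' \<circ>\<^bsub>C\<^esub> d \<and>
          h' \<circ>\<^bsub>C\<^esub> e = g' \<and> push C A d \<delta>'' = \<delta> \<and> pull C E f \<delta>'' = push C B e \<delta>'"
      by metis
  next
    fix D A B f' f \<delta> F Z g' g \<delta>'
    assume "etriangle C B A D f f' \<delta>" "etriangle C Z B F g g' \<delta>'"
    from ET4[OF this(2,1)]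
    show "\<exists>E h' d e \<delta>''. etriangle C Z A E (f \<circ>\<^bsub>C\<^esub> g) h' \<delta>'' \<and>
          etriangle C F E D e d (push C D g' \<delta>) \<and> d \<circ>\<^bsub>C\<^esub> h' = f' \<and>
          h' \<circ>\<^bsub>C\<^esub> f = e \<circ>\<^bsub>C\<^esub> g' \<and> pull C Z e \<delta>'' = \<delta>' \<and> pull C B d \<delta> = push C E g \<delta>''"
      by metis
  next
    show "(i1, p2) \<in> realise (opposite C) Z A \<zero>\<^bsub>Ext C A Z\<^esub>"
      if "biproduct C A Z S p1 p2 i1 i2" for A Z S i1 i2 p1 p2
      using real_zero[OF biproduct_swap[OF that]] by (simp add: opposite_def)
  next
    show "push C Y' c (pull C X a \<delta>) = pull C X' a (push C Y c \<delta>)" if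
      "X \<in> obj C" "X' \<in> obj C" "Y \<in> obj C" "Y' \<in> obj C"
      "a \<in> homset C Y' Y" "c \<in> homset C X X'" "\<delta> \<in> carrier (Ext C Y X)" for X X' Y Y' a c \<delta>
      using pull_push[OF that(3,4,1,2,6,5,7)] by simp
  qed (fact Ext_module pull_linear pull_linear_mor pull_ident push_linear push_linear_mor push_ident
    | (rule Ext_module pull_linear pull_linear_mor pull_ident pull_comp
         push_linear push_linear_mor push_ident push_comp; assumption))+
qed

section \<open>Index and coindex are mutually inverse\<close>

context extriangulated_category
begin

lemma index_hom:
  assumes T: "cluster_tilting C T" and U: "cluster_tilting C U"
  shows "index_hom C T U \<in> hom (K0 C T) (K0 C U)"
    and "X \<in> T \<Longrightarrow> index_hom C T U (K0_class C T X) = index C U X"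
proof -
  have "index C U \<in> T \<rightarrow> carrier (K0 C U)"
    using index_closed[OF U] cluster_tilting_obj[OF T] by blast
  note hom = K0_the_hom[where C = C, OF K0_comm_group this index_biproduct[OF U],
      folded index_hom_def]
  show "index_hom C T U \<in> hom (K0 C T) (K0 C U)"
    by (rule hom(1))
  show "X \<in> T \<Longrightarrow> index_hom C T U (K0_class C T X) = index C U X"
    by (rule hom(2))
qed

lemma coindex_hom:
  assumes T: "cluster_tilting C T" and U: "cluster_tilting C U"
  shows "coindex_hom C T U \<in> hom (K0 C T) (K0 C U)"
    and "X \<in> T \<Longrightarrow> coindex_hom C T U (K0_class C T X) = coindex C U X"
  using extriangulated_category.index_hom[OF opposite_extriangulated_category[OF
      extriangulated_category_axioms], of T U] T U
  by (simp_all add: cluster_tilting_opposite index_hom_opposite index_opposite K0_opposite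
      K0_class_opposite)

lemma coindex_conflation:
  assumes T: "cluster_tilting C T" and c: "conflation C A B Z x y" and Z: "Z \<in> T"
  shows "coindex C T B = K0_class C T Z \<otimes>\<^bsub>K0 C T\<^esub> coindex C T A"
  using extriangulated_category.index_conflation[OF opposite_extriangulated_category[OF
      extriangulated_category_axioms], of T Z B A y x] assms
  by (simp add: cluster_tilting_opposite index_opposite K0_class_opposite K0_opposite)

text \<open>
  A resolution \<open>A \<rightarrow> R \<rightarrow> X\<close> of \<open>X \<in> T\<close> by objects of \<open>U\<close> computes the index of \<open>X\<close> as \<open>[R] - [A]\<close>. Since its
  right end lies in \<open>T\<close>, the coindex with respect to \<open>T\<close> is additive on the same conflation, and
  \<open>coind [R] - coind [A] = [X]\<close>.
\<close>

lemma coindex_index: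
  assumes T: "cluster_tilting C T" and U: "cluster_tilting C U"
    and g: "g \<in> carrier (K0 C T)"
  shows "coindex_hom C U T (index_hom C T U g) = g"
proof -
  interpret T: comm_group "K0 C T" by (rule K0_comm_group)
  interpret U: comm_group "K0 C U" by (rule K0_comm_group)
  interpret coind: group_hom "K0 C U" "K0 C T" "coindex_hom C U T"
    using coindex_hom(1)[OF U T] by unfold_locales
  have "coindex_hom C U T (index_hom C T U (K0_class C T X)) = K0_class C T X" if X: "X \<in> T" for X
  proof -
    obtain A R x y where r: "A \<in> U" "R \<in> U" "conflation C A R X x y"
      using resolution_exists[OF U cluster_tilting_obj[OF T X]] by blast
    note o = r(1,2)[THEN cluster_tilting_obj[OF U]]
    have cl: "coindex C T A \<in> carrier (K0 C T)"
      using coind.hom_closed[OF class_closed[OF U r(1)]] coindex_hom(2)[OF U T r(1)] by simp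
    have "index_hom C T U (K0_class C T X) =
        K0_class C U R \<otimes>\<^bsub>K0 C U\<^esub> inv\<^bsub>K0 C U\<^esub> K0_class C U A"
      using index_hom(2)[OF T U X] index_eqI[OF U r(3,1,2)] by simp
    then have "coindex_hom C U T (index_hom C T U (K0_class C T X)) =
        coindex C T R \<otimes>\<^bsub>K0 C T\<^esub> inv\<^bsub>K0 C T\<^esub> coindex C T A"
      using r(1,2)[THEN class_closed[OF U]] r(1,2)[THEN coindex_hom(2)[OF U T]] by simp
    also have "\<dots> = K0_class C T X"
      using coindex_conflation[OF T r(3) X] class_closed[OF T X] cl
      by (simp add: T.m_assoc)
    finally show ?thesis .
  qed
  moreover have "(\<lambda>g. coindex_hom C U T (index_hom C T U g)) \<in> hom (K0 C T) (K0 C T)"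
    using hom_compose[OF index_hom(1)[OF T U] coindex_hom(1)[OF U T]] by (simp only: comp_def)
  moreover have "(\<lambda>g. g) \<in> hom (K0 C T) (K0 C T)"
    by (simp add: hom_def)
  ultimately show ?thesis
    using K0_hom_eqI[OF T.group_axioms _ _ _ g] by blast
qed

text \<open>
  In the opposite category, index and coindex change places.
\<close>

lemma index_coindex:
  assumes T: "cluster_tilting C T" and U: "cluster_tilting C U"
    and g: "g \<in> carrier (K0 C U)"
  shows "index_hom C T U (coindex_hom C U T g) = g"
  using extriangulated_category.coindex_index[OF opposite_extriangulated_category[OF
      extriangulated_category_axioms], of U T g] assms
  by (simp add: cluster_tilting_opposite index_hom_opposite coindex_hom_opposite K0_opposite)

end

theorem proposition3p29:
  fixes K :: "'k ring"
    and C :: "('o, 'm, 'k, 'e) extcat"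
    and T U :: "'o set"
  assumes "perfect_field K"
    and "cluster_category TYPE('p \<times> 'q) K C"
    and "cluster_tilting C T"
    and "cluster_tilting C U"
  shows "index_hom C T U \<in> iso (K0 C T) (K0 C U) \<and>
    coindex_hom C U T \<in> hom (K0 C U) (K0 C T) \<and>
    (\<forall>g \<in> carrier (K0 C T). coindex_hom C U T (index_hom C T U g) = g) \<and>
    (\<forall>g \<in> carrier (K0 C U). index_hom C T U (coindex_hom C U T g) = g)"
proof -
  interpret extriangulated_category K C
    using assms(2) unfolding cluster_category_def by blast
  note ind = index_hom(1)[OF assms(3,4)] and coind = coindex_hom(1)[OF assms(4,3)]
  have inverse: "\<forall>g \<in> carrier (K0 C T). coindex_hom C U T (index_hom C T U g) = g"
    "\<forall>g \<in> carrier (K0 C U). index_hom C T U (coindex_hom C U T g) = g"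
    using coindex_index[OF assms(3,4)] index_coindex[OF assms(3,4)] by blast+
  have "bij_betw (index_hom C T U) (carrier (K0 C T)) (carrier (K0 C U))"
    by (rule bij_betw_byWitness[where f' = "coindex_hom C U T"])
      (use inverse ind coind in \<open>auto simp: hom_def\<close>)
  then show ?thesis
    using ind coind inverse by (simp add: iso_def)
qed

end
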